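(* Let $d\ge2$, $0<s<d$, and let $(x_n)_{n\in\mathbb{N}}$ be a greedy sequence on $\mathbb{S}^d$ for $K_s$. Let $\omega_{N,d}$ denote the set of the first $N$ points of this sequence. For every $\varepsilon>0$ there exists $X_{s,d,\varepsilon}>0$ (depending only on $s,d,\varepsilon$) such that for all sufficiently large $N$, $$\#\left\{1\le j\le N:\ P_{K_s}(\omega_{j,d})\ge j\cdot\mathcal{I}_{s,d}-X_{s,d,\varepsilon}\cdot j^{s/d}\right\}\ge(1-\varepsilon)N.$$
   Context: $\mathbb{S}^d\subset\mathbb{R}^{d+1}$ is the unit sphere with Euclidean norm $\|\cdot\|$, and $\sigma_d$ is the surface measure normalized by $\sigma_d(\mathbb{S}^d)=1$. For $s>0$ the Riesz $s$-kernel is $K_s(x,y)=\|x-y\|^{-s}$ (with value $+\infty$ at $x=y$). For $\omega_{N,d}=\{x_1,\dots,x_N\}$, $P_{K_s}(\omega_{N,d})=\min_{x\in\mathbb{S}^d}\sum_{j=1}^N K_s(x,x_j)$. For $s<d$, $\mathcal{I}_{s,d}=\int_{\mathbb{S}^d}\int_{\mathbb{S}^d}K_s(x,y)\,d\sigma_d(x)\,d\sigma_d(y)$. A greedy sequence for $K_s$ starts from an arbitrary finite initial set of points $\{x_1,\dots,x_m\}\subset\mathbb{S}^d$, $m\ge1$, and for every $N\ge m$, $x_{N+1}$ is a minimizer (any one, if not unique) over $x\in\mathbb{S}^d$ of $\sum_{i=1}^{N}K_s(x,x_i)$. *)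

theory Defs
  imports "HOL-Probability.Probability"
begin

(* Normalized surface measure on the unit sphere: uniform measure on the unit ball pushed forward
   along x / norm x = sgn x, i.e. the normalized volume of the cone over a set. It is a Borel measure
   on the ambient space, but concentrated on the sphere and invariant under rotations, see
   sphere_measure_sphere and sphere_measure_rotation_invariant. *)
definition sphere_measure :: "'a::euclidean_space measure" where
  "sphere_measure = distr (uniform_measure lborel (cball 0 1)) borel sgn"

definition riesz_kernel :: "real \<Rightarrow> 'a::euclidean_space \<Rightarrow> 'a \<Rightarrow> ennreal" where
  "riesz_kernel s x y = (if x = y then \<infinity> else ennreal (norm (x - y) powr (- s)))"

(* Point sequences are indexed from 1: the first N points are x 1, ..., x N, and x 0 is ignored.
   For Riesz kernels the infimum is a minimum, see polarization_attained. *)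
definition polarization :: "('a::euclidean_space \<Rightarrow> 'a \<Rightarrow> ennreal) \<Rightarrow> (nat \<Rightarrow> 'a) \<Rightarrow> nat \<Rightarrow> ennreal" where
  "polarization K x N = (INF y\<in>sphere 0 1. \<Sum>i=1..N. K y (x i))"

definition sphere_energy :: "('a::euclidean_space \<Rightarrow> 'a \<Rightarrow> ennreal) \<Rightarrow> ennreal" where
  "sphere_energy K = (\<integral>\<^sup>+x. \<integral>\<^sup>+y. K x y \<partial>sphere_measure \<partial>sphere_measure)"

definition greedy_sequence :: "('a::euclidean_space \<Rightarrow> 'a \<Rightarrow> ennreal) \<Rightarrow> (nat \<Rightarrow> 'a) \<Rightarrow> bool" where
  "greedy_sequence K x \<longleftrightarrow> (\<exists>m\<ge>1. (\<forall>i\<in>{1..m}. x i \<in> sphere 0 1) \<and>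
     (\<forall>N\<ge>m. is_arg_min (\<lambda>y. \<Sum>i=1..N. K y (x i)) (\<lambda>y. y \<in> sphere 0 1) (x (N + 1))))"

lemma sgn_borel_measurable[measurable]: "(sgn :: 'a::euclidean_space \<Rightarrow> 'a) \<in> borel_measurable borel"
  unfolding sgn_div_norm[abs_def] by measurable

lemma emeasure_sphere_measure:
  assumes A: "A \<in> sets borel"
  shows "emeasure (sphere_measure :: 'a::euclidean_space measure) A =
    emeasure lborel {x \<in> cball 0 1. sgn x \<in> A} / emeasure lborel (cball (0::'a) 1)"
proof -
  have "emeasure (sphere_measure :: 'a measure) A
      = emeasure (uniform_measure lborel (cball (0::'a) 1)) (sgn -` A)"
    unfolding sphere_measure_def using A by (subst emeasure_distr) auto
  also have "\<dots> = emeasure lborel (cball 0 1 \<inter> sgn -` A) / emeasure lborel (cball (0::'a) 1)"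
    using measurable_sets[OF sgn_borel_measurable A]
    by (subst emeasure_uniform_measure) auto
  also have "cball 0 1 \<inter> sgn -` A = {x \<in> cball (0::'a) 1. sgn x \<in> A}"
    by auto
  finally show ?thesis .
qed

lemma emeasure_cball_pos: "emeasure lborel (cball (0::'a::euclidean_space) 1) \<noteq> 0"
  "emeasure lborel (cball (0::'a::euclidean_space) 1) \<noteq> \<infinity>"
proof -
  show "emeasure lborel (cball (0::'a) 1) \<noteq> 0"
    using emeasure_cball[of 1 "0::'a"] unit_ball_vol_pos[of "real DIM('a)"] by (simp del: unit_ball_vol_pos)
  show "emeasure lborel (cball (0::'a) 1) \<noteq> \<infinity>"
    using emeasure_lborel_cball_finite[of "0::'a" 1] by simp
qed

lemma prob_space_sphere_measure: "prob_space (sphere_measure :: 'a::euclidean_space measure)"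
  unfolding sphere_measure_def
  by (intro prob_space.prob_space_distr prob_space_uniform_measure emeasure_cball_pos) auto

lemma sphere_measure_sphere: "emeasure sphere_measure (sphere (0::'a::euclidean_space) 1) = 1"
proof -
  have "{x \<in> cball (0::'a) 1. sgn x \<in> sphere 0 1} = cball 0 1 - {0}"
    by (auto simp: norm_sgn)
  moreover have "emeasure lborel (cball (0::'a) 1 - {0}) = emeasure lborel (cball (0::'a) 1)"
    by (rule emeasure_Diff_null_set) auto
  ultimately show ?thesis
    using emeasure_cball_pos[where 'a='a]
    by (simp add: emeasure_sphere_measure ennreal_divide_self less_top)
qed

lemma nn_integral_lborel_shift:
  fixes c :: "'a::euclidean_space"
  assumes [measurable]: "f \<in> borel_measurable borel"
  shows "(\<integral>\<^sup>+x. f (c + x) \<partial>lborel) = (\<integral>\<^sup>+x. f x \<partial>lborel)"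
proof -
  have "(\<integral>\<^sup>+x. f x \<partial>lborel) = (\<integral>\<^sup>+x. f x \<partial>distr lborel borel ((+) c))"
    by (simp only: lborel_distr_plus)
  also have "\<dots> = (\<integral>\<^sup>+x. f (c + x) \<partial>lborel)"
    by (rule nn_integral_distr) auto
  finally show ?thesis by simp
qed

lemma emeasure_lborel_orthogonal_vimage:
  fixes T :: "'a::euclidean_space \<Rightarrow> 'a"
  assumes T: "orthogonal_transformation T" and A[measurable]: "A \<in> sets borel"
  shows "emeasure lborel (T -` A) = emeasure lborel A"
proof -
  have lin: "linear T" using T by (rule orthogonal_transformation_linear)
  have T_meas[measurable]: "T \<in> borel_measurable borel"
    using lin by (intro borel_measurable_continuous_onI linear_continuous_on linear_conv_bounded_linear[THEN iffD1])
  have TA: "T -` A \<in> sets borel"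
    using measurable_sets[OF T_meas A] by simp
  define B where "B = cball (0::'a) 1"
  have B[measurable]: "B \<in> sets borel" by (simp add: B_def)
  have ball: "emeasure lborel (cball w 1) = emeasure lborel B" for w :: 'a
    by (simp add: B_def emeasure_cball)
  have shift1: "(\<integral>\<^sup>+x. indicator A (T x + y) \<partial>lborel) = emeasure lborel (T -` A)" for y
  proof -
    obtain w where w: "y = T w"
      using orthogonal_transformation_surj[OF T] by blast
    have "(\<integral>\<^sup>+x. indicator A (T x + y) \<partial>lborel) = (\<integral>\<^sup>+x. indicator A (T (w + x)) \<partial>lborel)"
      by (simp add: w linear_add[OF lin] add.commute)
    also have "\<dots> = (\<integral>\<^sup>+x. indicator A (T x) \<partial>lborel)"
      by (rule nn_integral_lborel_shift[where f = "\<lambda>x. indicator A (T x)"]) measurable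
    also have "\<dots> = (\<integral>\<^sup>+x. indicator (T -` A) x \<partial>lborel)"
      by (simp add: indicator_def)
    finally show ?thesis using TA by simp
  qed
  have shift2: "(\<integral>\<^sup>+x. indicator B (z - T x) \<partial>lborel) = emeasure lborel B" for z
  proof -
    obtain w where w: "z = T w"
      using orthogonal_transformation_surj[OF T] by blast
    have "indicator B (z - T x) = (indicator (cball w 1) x :: ennreal)" for x
      using orthogonal_transformation_norm[OF T, of "w - x"]
      by (simp add: indicator_def B_def w dist_norm linear_diff[OF lin] norm_minus_commute)
    then show ?thesis using ball[of w] by simp
  qed
  have "emeasure lborel (T -` A) * emeasure lborel B
      = (\<integral>\<^sup>+y. indicator B y * (\<integral>\<^sup>+x. indicator A (T x + y) \<partial>lborel) \<partial>lborel)"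
    unfolding shift1 by (subst nn_integral_multc) (simp_all add: mult.commute)
  also have "\<dots> = (\<integral>\<^sup>+y. (\<integral>\<^sup>+x. indicator B y * indicator A (T x + y) \<partial>lborel) \<partial>lborel)"
    by (intro nn_integral_cong nn_integral_cmult[symmetric]) measurable
  also have "\<dots> = (\<integral>\<^sup>+x. (\<integral>\<^sup>+y. indicator B y * indicator A (T x + y) \<partial>lborel) \<partial>lborel)"
    by (rule lborel_pair.Fubini') measurable
  also have "\<dots> = (\<integral>\<^sup>+x. (\<integral>\<^sup>+z. indicator B (z - T x) * indicator A z \<partial>lborel) \<partial>lborel)"
  proof (rule nn_integral_cong)
    fix x
    have "(\<integral>\<^sup>+y. indicator B (T x + y - T x) * indicator A (T x + y) \<partial>lborel)
        = (\<integral>\<^sup>+z. indicator B (z - T x) * indicator A z \<partial>lborel :: ennreal)"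
      by (rule nn_integral_lborel_shift[where f = "\<lambda>z. indicator B (z - T x) * indicator A z"]) measurable
    then show "(\<integral>\<^sup>+y. indicator B y * indicator A (T x + y) \<partial>lborel)
        = (\<integral>\<^sup>+z. indicator B (z - T x) * indicator A z \<partial>lborel :: ennreal)"
      by simp
  qed
  also have "\<dots> = (\<integral>\<^sup>+z. (\<integral>\<^sup>+x. indicator B (z - T x) * indicator A z \<partial>lborel) \<partial>lborel)"
    by (rule lborel_pair.Fubini') measurable
  also have "\<dots> = (\<integral>\<^sup>+z. (\<integral>\<^sup>+x. indicator B (z - T x) \<partial>lborel) * indicator A z \<partial>lborel)"
    by (intro nn_integral_cong nn_integral_multc) measurable
  also have "\<dots> = emeasure lborel A * emeasure lborel B"
    unfolding shift2 by (simp add: nn_integral_cmult_indicator mult.commute[of "emeasure lborel A"])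
  finally have "emeasure lborel B * emeasure lborel (T -` A) = emeasure lborel B * emeasure lborel A"
    by (simp add: mult.commute)
  then show ?thesis
    using emeasure_cball_pos[where 'a = 'a]
    by (simp add: ennreal_mult_cancel_left B_def)
qed

lemma sphere_measure_rotation_invariant:
  fixes T :: "'a::euclidean_space \<Rightarrow> 'a"
  assumes T: "orthogonal_transformation T"
  shows "distr sphere_measure borel T = sphere_measure"
proof (rule measure_eqI)
  show "sets (distr sphere_measure borel T) = sets (sphere_measure :: 'a measure)"
    by (simp add: sphere_measure_def)
next
  fix A assume "A \<in> sets (distr sphere_measure borel T)"
  then have A: "A \<in> sets borel" by simp
  have lin: "linear T" using T by (rule orthogonal_transformation_linear)
  have T_meas: "T \<in> borel_measurable borel"
    using lin by (intro borel_measurable_continuous_onI linear_continuous_on linear_conv_bounded_linear[THEN iffD1])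
  then have TA: "T -` A \<in> sets borel"
    using measurable_sets[OF T_meas A] by simp
  have "{x \<in> cball 0 1. sgn x \<in> A} = cball (0::'a) 1 \<inter> sgn -` A" by auto
  then have C: "{x \<in> cball (0::'a) 1. sgn x \<in> A} \<in> sets borel"
    using measurable_sets[OF sgn_borel_measurable A] by auto
  have "sgn (T x) = T (sgn x)" for x
    using T lin by (simp add: sgn_div_norm orthogonal_transformation_norm linear_scale)
  then have "{x \<in> cball 0 1. sgn x \<in> T -` A} = T -` {x \<in> cball 0 1. sgn x \<in> A}"
    using T by (auto simp: orthogonal_transformation_norm)
  then have "emeasure lborel {x \<in> cball 0 1. sgn x \<in> T -` A} = emeasure lborel {x \<in> cball 0 1. sgn x \<in> A}"
    using emeasure_lborel_orthogonal_vimage[OF T C] by simp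
  moreover have "emeasure (distr sphere_measure borel T) A = emeasure sphere_measure (T -` A)"
    using T_meas A by (subst emeasure_distr) (auto simp: sphere_measure_def)
  ultimately show "emeasure (distr sphere_measure borel T) A = emeasure sphere_measure A"
    unfolding emeasure_sphere_measure[OF A] by (simp only: emeasure_sphere_measure[OF TA])
qed

lemma continuous_on_riesz_kernel:
  assumes "s > 0"
  shows "continuous_on S (\<lambda>x. riesz_kernel s x y)"
proof -
  have eq: "riesz_kernel s x y = inverse (ennreal (norm (x - y) powr s))" for x
    by (auto simp: riesz_kernel_def powr_minus inverse_ennreal)
  show ?thesis unfolding eq
    using assms by (intro continuous_on_inverse_ennreal continuous_on_ennreal continuous_on_powr'
      continuous_intros) auto
qed

lemma polarization_attained:
  assumes "s > 0"
  shows "\<exists>y\<in>sphere (0::'a::euclidean_space) 1.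
    polarization (riesz_kernel s) x N = (\<Sum>i=1..N. riesz_kernel s y (x i))"
proof -
  let ?f = "\<lambda>y. \<Sum>i=1..N. riesz_kernel s y (x i)"
  have "continuous_on (sphere (0::'a) 1) ?f"
    using assms by (intro continuous_on_sum continuous_on_riesz_kernel)
  moreover have "sphere (0::'a) 1 \<noteq> {}"
    by simp
  ultimately have "\<exists>y\<in>sphere (0::'a) 1. \<forall>z\<in>sphere 0 1. ?f y \<le> ?f z"
    by (intro continuous_attains_inf compact_sphere)
  then obtain y where "y \<in> sphere (0::'a) 1" "\<forall>z\<in>sphere 0 1. ?f y \<le> ?f z"
    by (rule bexE)
  then show ?thesis unfolding polarization_def
    by (intro bexI[of _ y]) (auto intro!: antisym INF_lower INF_greatest)
qed

end

theory Submission
  imports Defs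
begin

text \<open>
  Up to a constant factor, $|x - y|^{-s} = \int_0^\infty |B(x, r) \cap B(y, r)|\, r^{-s-D-1}\, dr$ with
  $D = d + 1$ (the formula of Fefferman and de la Llave). Every $|B(x, r) \cap B(y, r)|$ is a bounded
  positive definite kernel, so its double sum over $N$ points of the sphere is at least $N^2$ times its
  mean. Cutting the integral off at $r = t$ gives a kernel below $|x - y|^{-s}$ with diagonal of order
  $t^{-s}$ and, since spherical caps of radius $r$ have measure $O(r^d)$, with mean smaller by
  $O(t^{d-s})$. For $t = N^{-1/d}$ both errors contribute $O(N^{1+s/d})$ to the energy of $N$ points.
  Along a greedy sequence that energy is, up to the initial points, $2 \sum_{j<N} P_{K_s}(\omega_j)$.
  Hence the nonnegative deficits $j\, \mathcal{I}_{s,d} - P_{K_s}(\omega_j)$ with $j < N$ sum to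
  $O(N^{1+s/d})$, and only a small proportion of them can exceed $X j^{s/d}$ when $X$ is large.
\<close>

section \<open>Measurability of balls and the support of the surface measure\<close>

text \<open>Membership is rewritten as a distance inequality, which is jointly measurable even when
  centre and radius vary; the exchanges of integrals below need this.\<close>

lemma borel_measurable_indicator_cball:
  fixes f h :: "'b \<Rightarrow> 'a::euclidean_space"
  assumes [measurable]: "f \<in> borel_measurable M" "g \<in> borel_measurable M" "h \<in> borel_measurable M"
  shows "(\<lambda>p. indicator (cball (f p) (g p)) (h p) :: ennreal) \<in> borel_measurable M"
proof -
  have "(\<lambda>p. indicator (cball (f p) (g p)) (h p) :: ennreal)
      = (\<lambda>p. if dist (f p) (h p) \<le> g p then 1 else 0)"
    by (auto simp: indicator_def)
  then show ?thesis by simp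
qed

lemma sets_sphere_measure [measurable_cong, simp]: "sets sphere_measure = sets borel"
  by (simp add: sphere_measure_def)

lemma space_sphere_measure [simp]: "space sphere_measure = UNIV"
  by (simp add: sphere_measure_def)

lemma AE_sphere_measure: "AE x in sphere_measure. x \<in> sphere (0::'a::euclidean_space) 1"
proof -
  interpret prob_space "sphere_measure :: 'a measure"
    by (rule prob_space_sphere_measure)
  have "prob (sphere 0 1) = 1"
    by (simp add: measure_def sphere_measure_sphere)
  then show ?thesis
    by (rule AE_prob_1)
qed

subsection \<open>Overlaps of balls\<close>

definition ball_overlap :: "real \<Rightarrow> 'a::euclidean_space \<Rightarrow> 'a \<Rightarrow> ennreal" where
  "ball_overlap r x y = emeasure lborel (cball x r \<inter> cball y r)"

text \<open>Since \<open>z\<close> lies in the ball around \<open>x\<close> iff \<open>x\<close>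
  lies in the ball around \<open>z\<close>, the overlap is a superposition over \<open>z\<close> of
  products \<open>f z x * f z y\<close>. Positive definiteness comes from this form.\<close>

lemma ball_overlap_eq_nn_integral:
  "ball_overlap r x y = (\<integral>\<^sup>+z. indicator (cball z r) x * indicator (cball z r) y \<partial>lborel)"
proof -
  have "ball_overlap r x y = (\<integral>\<^sup>+z. indicator (cball x r \<inter> cball y r) z \<partial>lborel)"
    by (simp add: ball_overlap_def)
  also have "\<dots> = (\<integral>\<^sup>+z. indicator (cball z r) x * indicator (cball z r) y \<partial>lborel)"
    by (intro nn_integral_cong) (auto simp: indicator_def dist_commute)
  finally show ?thesis .
qed

lemma borel_measurable_ball_overlap [measurable]:
  fixes g h :: "'b \<Rightarrow> 'a::euclidean_space"
  assumes [measurable]: "f \<in> borel_measurable M" "g \<in> borel_measurable M" "h \<in> borel_measurable M"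
  shows "(\<lambda>p. ball_overlap (f p) (g p) (h p)) \<in> borel_measurable M"
  unfolding ball_overlap_eq_nn_integral
  by (intro lborel.borel_measurable_nn_integral)
     (simp add: split_beta', intro borel_measurable_times_ennreal borel_measurable_indicator_cball; measurable)

lemma ball_overlap_self:
  fixes x :: "'a::euclidean_space"
  shows "r \<ge> 0 \<Longrightarrow> ball_overlap r x x = ennreal (unit_ball_vol DIM('a) * r ^ DIM('a))"
  by (simp add: ball_overlap_def emeasure_cball)

lemma ball_overlap_le_self: "ball_overlap r x y \<le> ball_overlap r x x"
  unfolding ball_overlap_def by (intro emeasure_mono) auto

lemma ball_overlap_self_eq: "ball_overlap r (x::'a::euclidean_space) x = ball_overlap r (y::'a) y"
  by (cases "r \<ge> 0") (simp_all add: ball_overlap_self ball_overlap_def[of r] emeasure_cball not_le)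

lemma ball_overlap_eq_0: "2 * r < dist x y \<Longrightarrow> ball_overlap r x y = 0"
proof -
  assume "2 * r < dist x y"
  then have "cball x r \<inter> cball y r = {}"
    by (auto simp: disjoint_iff) (smt (verit) dist_commute dist_triangle)
  then show ?thesis by (simp add: ball_overlap_def)
qed

text \<open>The ball of radius \<open>r / 2\<close> about the midpoint fits into both balls. This
  later shows that the kernel built from overlaps does not vanish.\<close>

lemma ball_overlap_ge:
  fixes x y :: "'a::euclidean_space"
  assumes "dist x y \<le> r"
  shows "ennreal (unit_ball_vol DIM('a) * (r / 2) ^ DIM('a)) \<le> ball_overlap r x y"
proof -
  have r: "r \<ge> 0" using assms zero_le_dist[of x y] by linarith
  have "cball (midpoint x y) (r / 2) \<subseteq> cball x r \<inter> cball y r"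
  proof
    fix z assume z: "z \<in> cball (midpoint x y) (r / 2)"
    have "dist x z \<le> dist x (midpoint x y) + dist (midpoint x y) z"
      by (rule dist_triangle)
    moreover have "dist y z \<le> dist y (midpoint x y) + dist (midpoint x y) z"
      by (rule dist_triangle)
    ultimately show "z \<in> cball x r \<inter> cball y r"
      using z assms by (simp add: dist_midpoint dist_commute)
  qed
  then have "emeasure lborel (cball (midpoint x y) (r / 2)) \<le> ball_overlap r x y"
    unfolding ball_overlap_def by (intro emeasure_mono) auto
  then show ?thesis using r by (simp add: emeasure_cball)
qed

lemma ball_overlap_orthogonal:
  fixes T :: "'a::euclidean_space \<Rightarrow> 'a"
  assumes T: "orthogonal_transformation T"
  shows "ball_overlap r (T x) (T y) = ball_overlap r x y"
proof -
  have "dist (T a) (T b) = dist a b" for a b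
    using T[unfolded orthogonal_transformation_isometry] by blast
  then have "T -` (cball (T x) r \<inter> cball (T y) r) = cball x r \<inter> cball y r"
    by auto
  then show ?thesis
    using emeasure_lborel_orthogonal_vimage[OF T, of "cball (T x) r \<inter> cball (T y) r"]
    by (simp add: ball_overlap_def)
qed

lemma ball_overlap_affine:
  fixes x y :: "'a::euclidean_space"
  assumes "a > 0"
  shows "ball_overlap (a * r) (c + a *\<^sub>R x) (c + a *\<^sub>R y) = ennreal (a ^ DIM('a)) * ball_overlap r x y"
proof -
  let ?A = "cball (c + a *\<^sub>R x) (a * r) \<inter> cball (c + a *\<^sub>R y) (a * r)"
  have d: "dist (c + a *\<^sub>R u) (c + a *\<^sub>R v) = a * dist u v" for u v :: 'a
    using assms by (simp add: dist_norm scaleR_diff_right[symmetric])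
  have v: "(\<lambda>z. c + a *\<^sub>R z) -` ?A = cball x r \<inter> cball y r"
    using assms by (auto simp: d simp del: dist_add_cancel)
  have m: "(\<lambda>z. c + a *\<^sub>R z) \<in> borel_measurable borel" by simp
  have "ball_overlap (a * r) (c + a *\<^sub>R x) (c + a *\<^sub>R y)
      = emeasure (density (distr lborel borel (\<lambda>x. c + a *\<^sub>R x)) (\<lambda>_. ennreal (\<bar>a\<bar> ^ DIM('a)))) ?A"
    unfolding ball_overlap_def using assms by (subst lborel_affine[of a c]) auto
  also have "\<dots> = ennreal (a ^ DIM('a)) * ball_overlap r x y"
    using assms m
    by (subst emeasure_density)
       (auto simp: nn_integral_cmult_indicator emeasure_distr v[simplified vimage_Int] ball_overlap_def)
  finally show ?thesis .
qed

section \<open>The measure of spherical caps\<close>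

text \<open>The measure of a cap is the relative volume of the cone over it in the unit ball. About
  \<open>1 / r\<close> balls of radius \<open>2 * r\<close> with centres on the axis cover that
  cone, which gives the order \<open>r ^ (DIM('a) - 1)\<close>. For \<open>r > 1\<close> the bound
  exceeds the total mass.\<close>

lemma sphere_measure_cball_le:
  fixes x :: "'a::euclidean_space"
  assumes x: "norm x = 1" and r: "r > 0"
  shows "emeasure sphere_measure (cball x r) \<le> ennreal (2 ^ (DIM('a) + 1) * r ^ (DIM('a) - 1))"
proof (cases "r \<le> 1")
  case False
  have "1 \<le> r ^ (DIM('a) - 1)" using False by (intro one_le_power) auto
  then have "1 \<le> 2 ^ (DIM('a) + 1) * r ^ (DIM('a) - 1)"
    using mult_mono[of 1 "2 ^ (DIM('a) + 1)" 1 "r ^ (DIM('a) - 1)"] one_le_power[of "2::real" "DIM('a) + 1"]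
    by (simp del: power_Suc One_nat_def)
  then show ?thesis
    using prob_space.emeasure_le_1[OF prob_space_sphere_measure, of "cball x r"]
    by (metis ennreal_1 ennreal_leI order_trans)
next
  case True
  define n where "n = nat \<lfloor>1 / r\<rfloor>"
  have n: "real n \<le> 1 / r" using r by (simp add: n_def)
  let ?A = "{z \<in> cball (0::'a) 1. sgn z \<in> cball x r}"
  \<comment> \<open>The cone over the cap lies within distance $r$ of the segment from $0$ to $x$.\<close>
  have sub: "?A \<subseteq> (\<Union>k\<in>{..n}. cball ((real k * r) *\<^sub>R x) (2 * r))"
  proof
    fix z assume z: "z \<in> ?A"
    \<comment> \<open>The covering ball for \<open>z\<close> is centred at the last axis point of a
      grid of mesh \<open>r\<close> that is no farther from the origin than \<open>z\<close>. This
      centre and \<open>z\<close> are each within \<open>r\<close> of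
      \<open>norm z *\<^sub>R x\<close>.\<close>
    define k where "k = nat \<lfloor>norm z / r\<rfloor>"
    have k: "real k \<le> norm z / r" "norm z / r < real k + 1"
      using r by (auto simp: k_def)
    have "norm z / r \<le> 1 / r" using z r by (intro divide_right_mono) auto
    then have "k \<le> n" unfolding k_def n_def by (intro nat_mono floor_mono)
    have "z = norm z *\<^sub>R sgn z" by (cases "z = 0") (simp_all add: sgn_div_norm)
    then have "norm z *\<^sub>R x - z = norm z *\<^sub>R (x - sgn z)"
      by (simp add: scaleR_diff_right)
    then have "dist (norm z *\<^sub>R x) z = norm z * dist x (sgn z)"
      by (simp add: dist_norm)
    also have "\<dots> \<le> 1 * r" using z by (intro mult_mono) auto
    finally have 1: "dist (norm z *\<^sub>R x) z \<le> r" by simp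
    have "dist ((real k * r) *\<^sub>R x) (norm z *\<^sub>R x) = \<bar>real k * r - norm z\<bar>"
      by (simp add: dist_norm scaleR_diff_left[symmetric] x)
    also have "\<dots> \<le> r" using k r by (simp add: field_simps abs_le_iff)
    finally have "dist ((real k * r) *\<^sub>R x) z \<le> 2 * r"
      using 1 dist_triangle[of "(real k * r) *\<^sub>R x" z "norm z *\<^sub>R x"] by linarith
    then show "z \<in> (\<Union>k\<in>{..n}. cball ((real k * r) *\<^sub>R x) (2 * r))"
      using \<open>k \<le> n\<close> by auto
  qed
  let ?V = "unit_ball_vol (real DIM('a))"
  have V: "?V > 0" by simp
  obtain D where D: "DIM('a) = Suc D" using DIM_positive[where 'a='a] by (metis Suc_pred)
  have "emeasure lborel ?A \<le> emeasure lborel (\<Union>k\<in>{..n}. cball ((real k * r) *\<^sub>R x) (2 * r))"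
    by (intro emeasure_mono sub) auto
  also have "\<dots> \<le> (\<Sum>k\<in>{..n}. emeasure lborel (cball ((real k * r) *\<^sub>R x) (2 * r)))"
    by (intro emeasure_subadditive_finite) auto
  also have "\<dots> = of_nat (Suc n) * ennreal (?V * (2 * r) ^ DIM('a))"
    using r by (simp add: emeasure_cball)
  also have "\<dots> = ennreal (real (Suc n) * (?V * (2 * r) ^ DIM('a)))"
    using r V by (simp only: ennreal_of_nat_eq_real_of_nat) (simp add: ennreal_mult')
  also have "\<dots> \<le> ennreal (?V * (2 ^ (DIM('a) + 1) * r ^ (DIM('a) - 1)))"
  proof (rule ennreal_leI)
    \<comment> \<open>As \<open>r \<le> 1\<close>, the extra ball at the origin is absorbed:
      \<open>1 / r + 1 \<le> 2 / r\<close>.\<close>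
    have "real (Suc n) \<le> 2 / r" using n True r by (simp add: field_simps)
    then have "real (Suc n) * (?V * (2 * r) ^ DIM('a)) \<le> 2 / r * (?V * (2 * r) ^ DIM('a))"
      using r V by (intro mult_right_mono) auto
    also have "\<dots> = ?V * (2 ^ (DIM('a) + 1) * r ^ (DIM('a) - 1))"
      using r by (simp add: D power_mult_distrib)
    finally show "real (Suc n) * (?V * (2 * r) ^ DIM('a)) \<le> ?V * (2 ^ (DIM('a) + 1) * r ^ (DIM('a) - 1))" .
  qed
  finally have "emeasure lborel ?A / ennreal ?V
      \<le> ennreal (?V * (2 ^ (DIM('a) + 1) * r ^ (DIM('a) - 1))) / ennreal ?V"
    by (rule divide_right_mono_ennreal)
  also have "\<dots> = ennreal (2 ^ (DIM('a) + 1) * r ^ (DIM('a) - 1))"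
    using r V by (subst divide_ennreal) (simp_all add: less_imp_neq[OF V, symmetric] del: unit_ball_vol_pos)
  finally show ?thesis
    using V by (simp add: emeasure_sphere_measure emeasure_cball)
qed

section \<open>Integrals of powers\<close>

lemma nn_integral_powr_greaterThan:
  fixes e t :: real
  assumes "e < -1" "t > 0"
  shows "(\<integral>\<^sup>+r. ennreal (r powr e) * indicator {t<..} r \<partial>lborel) = ennreal (t powr (e + 1) / (- e - 1))"
proof -
  \<comment> \<open>Closing the half-line at \<open>t\<close> changes the integrand only on a null
    set.\<close>
  have "AE r in lborel. ennreal (r powr e) * indicator {t<..} r = ennreal (r powr e) * indicator {t..} r"
    using AE_lborel_singleton[of t]
  proof eventually_elim
    case (elim r)
    then have "r \<in> {t<..} \<longleftrightarrow> r \<in> {t..}" by auto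
    then show ?case by (simp only: indicator_def)
  qed
  then have "(\<integral>\<^sup>+r. ennreal (r powr e) * indicator {t<..} r \<partial>lborel)
      = (\<integral>\<^sup>+r. ennreal (r powr e) * indicator {t..} r \<partial>lborel)"
    by (rule nn_integral_cong_AE)
  also have "\<dots> = ennreal (- (t powr (e + 1)) / (e + 1))"
    by (rule nn_integral_has_integral_lebesgue'[OF _ has_integral_powr_to_inf[OF assms]]) (rule powr_ge_zero)
  also have "- (t powr (e + 1)) / (e + 1) = t powr (e + 1) / (- e - 1)"
    by (subst minus_divide_divide[symmetric]) simp
  finally show ?thesis .
qed

lemma nn_integral_powr_greaterThanAtMost:
  fixes e t :: real
  assumes "e > -1" "t \<ge> 0"
  shows "(\<integral>\<^sup>+r. ennreal (r powr e) * indicator {0<..t} r \<partial>lborel) = ennreal (t powr (e + 1) / (e + 1))"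
proof -
  have "AE r in lborel. ennreal (r powr e) * indicator {0<..t} r = ennreal (r powr e) * indicator {0..t} r"
    using AE_lborel_singleton[of "0::real"]
  proof eventually_elim
    case (elim r)
    then have "r \<in> {0<..t} \<longleftrightarrow> r \<in> {0..t}" by auto
    then show ?case by (simp only: indicator_def)
  qed
  then have "(\<integral>\<^sup>+r. ennreal (r powr e) * indicator {0<..t} r \<partial>lborel)
      = (\<integral>\<^sup>+r. ennreal (r powr e) * indicator {0..t} r \<partial>lborel)"
    by (rule nn_integral_cong_AE)
  also have "\<dots> = ennreal (t powr (e + 1) / (e + 1))"
    by (rule nn_integral_has_integral_lebesgue'[OF _ has_integral_powr_from_0[OF assms]]) (rule powr_ge_zero)
  finally show ?thesis .
qed

section \<open>Averages over the sphere and positive definiteness of the overlaps\<close>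

text \<open>Rotations act transitively on the sphere and preserve both \<open>H\<close> and the
  measure, so the potential of the uniform measure is constant on the sphere and equals its own
  average.\<close>

lemma nn_integral_sphere_invariant:
  fixes H :: "real ^ 'n \<Rightarrow> real ^ 'n \<Rightarrow> ennreal"
  assumes [measurable]: "\<And>x. H x \<in> borel_measurable borel"
    and inv: "\<And>T x y. orthogonal_transformation T \<Longrightarrow> H (T x) (T y) = H x y"
    and x: "x \<in> sphere 0 1"
  shows "(\<integral>\<^sup>+y. H x y \<partial>sphere_measure) = sphere_energy H"
proof -
  interpret prob_space "sphere_measure :: (real ^ 'n) measure"
    by (rule prob_space_sphere_measure)
  have const: "(\<integral>\<^sup>+y. H x' y \<partial>sphere_measure) = (\<integral>\<^sup>+y. H x y \<partial>sphere_measure)"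
    if "x' \<in> sphere 0 1" for x'
  proof -
    have "norm x = norm x'" using x that by simp
    then obtain T where T: "orthogonal_transformation T" "T x = x'"
      by (rule orthogonal_transformation_exists)
    have m: "T \<in> borel_measurable borel"
      using orthogonal_transformation_linear[OF T(1)]
      by (intro borel_measurable_continuous_onI linear_continuous_on linear_conv_bounded_linear[THEN iffD1])
    have "(\<integral>\<^sup>+y. H x' y \<partial>sphere_measure) = (\<integral>\<^sup>+y. H (T x) y \<partial>distr sphere_measure borel T)"
      using sphere_measure_rotation_invariant[OF T(1)] T(2) by simp
    also have "\<dots> = (\<integral>\<^sup>+y. H (T x) (T y) \<partial>sphere_measure)"
      using m by (intro nn_integral_distr) auto
    finally show ?thesis using inv[OF T(1)] by simp
  qed
  have "sphere_energy H = (\<integral>\<^sup>+x'. (\<integral>\<^sup>+y. H x y \<partial>sphere_measure) \<partial>(sphere_measure :: (real ^ 'n) measure))"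
    unfolding sphere_energy_def
  proof (rule nn_integral_cong_AE)
    show "AE x' in (sphere_measure :: (real ^ 'n) measure). (\<integral>\<^sup>+y. H x' y \<partial>sphere_measure) = (\<integral>\<^sup>+y. H x y \<partial>sphere_measure)"
      using AE_sphere_measure by eventually_elim (rule const)
  qed
  also have "\<dots> = (\<integral>\<^sup>+y. H x y \<partial>sphere_measure)"
    using emeasure_space_1 by simp
  finally show ?thesis by simp
qed

lemma two_mult_le_ennreal: "2 * (a * b) \<le> a * a + b * (b :: ennreal)"
proof (cases a; cases b)
  fix u v :: real assume uv: "a = ennreal u" "0 \<le> u" "b = ennreal v" "0 \<le> v"
  have "2 * (u * v) \<le> u * u + v * v"
    using sum_squares_bound[of u v] by (simp add: power2_eq_square)
  then have "ennreal (2 * (u * v)) \<le> ennreal (u * u + v * v)"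
    by (rule ennreal_leI)
  then have "ennreal 2 * (ennreal u * ennreal v) \<le> ennreal u * ennreal u + ennreal v * ennreal v"
    using uv by (simp only: ennreal_mult[symmetric] ennreal_plus[symmetric] mult_nonneg_nonneg)
  then show ?thesis using uv by simp
qed simp_all

text \<open>Overlaps are bounded by the volume of one ball and the measure has mass 1. Finiteness
  permits cancelling this mean in \<open>ennreal\<close>.\<close>

lemma sphere_energy_ball_overlap_finite:
  "sphere_energy (ball_overlap r :: 'a::euclidean_space \<Rightarrow> _) < \<infinity>"
proof -
  interpret prob_space "sphere_measure :: 'a measure"
    by (rule prob_space_sphere_measure)
  let ?c = "emeasure lborel (cball (0::'a) r)"
  have "ball_overlap r x y \<le> ?c" for x y :: 'a
    using ball_overlap_le_self[of r x y] ball_overlap_self_eq[of r x 0] by (simp add: ball_overlap_def)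
  then have "sphere_energy (ball_overlap r :: 'a \<Rightarrow> _) \<le> (\<integral>\<^sup>+x. \<integral>\<^sup>+y. ?c \<partial>(sphere_measure :: 'a measure) \<partial>(sphere_measure :: 'a measure))"
    unfolding sphere_energy_def by (intro nn_integral_mono)
  also have "\<dots> = ?c" using emeasure_space_1 by simp
  also have "\<dots> < \<infinity>" by (rule emeasure_lborel_cball_finite)
  finally show ?thesis .
qed

text \<open>
  With $F(z) = \sum_i 1_{|x_i - z| \le r}$ and $G(z) = \sigma(B(z, r))$ this is
  $2 \int F \cdot N G \le \int F^2 + \int (N G)^2$; by rotation invariance of the mean, the left-hand
  side is twice the last integral, which may be cancelled because it is finite.
\<close>
lemma ball_overlap_sum_ge:
  fixes x :: "'i \<Rightarrow> real ^ 'n"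
  assumes I: "finite I" and x: "\<And>i. i \<in> I \<Longrightarrow> x i \<in> sphere 0 1"
  shows "of_nat (card I) ^ 2 * sphere_energy (ball_overlap r :: real ^ 'n \<Rightarrow> _)
    \<le> (\<Sum>i\<in>I. \<Sum>j\<in>I. ball_overlap r (x i) (x j))"
proof -
  interpret prob_space "sphere_measure :: (real ^ 'n) measure"
    by (rule prob_space_sphere_measure)
  interpret pair_sigma_finite lborel "sphere_measure :: (real ^ 'n) measure"
    by unfold_locales
  define N :: ennreal where "N = of_nat (card I)"
  define F where "F z = (\<Sum>i\<in>I. indicator (cball z r) (x i) :: ennreal)" for z
  define G where "G z = (\<integral>\<^sup>+y. indicator (cball z r) y \<partial>sphere_measure)" for z :: "real ^ 'n"
  note [measurable] = borel_measurable_indicator_cball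
  have F_meas[measurable]: "F \<in> borel_measurable borel"
    unfolding F_def by measurable
  have G_meas[measurable]: "G \<in> borel_measurable borel"
    unfolding G_def by measurable
  let ?S = "sphere_energy (ball_overlap r :: real ^ 'n \<Rightarrow> _)"
  have FF: "(\<integral>\<^sup>+z. F z * F z \<partial>lborel) = (\<Sum>i\<in>I. \<Sum>j\<in>I. ball_overlap r (x i) (x j))"
    unfolding F_def ball_overlap_eq_nn_integral by (simp add: sum_product nn_integral_sum)
  \<comment> \<open>Integrating over the centres \<open>z\<close> first turns an indicator times
    \<open>G\<close> into the potential of the overlap kernel at \<open>u\<close>.\<close>
  have G_int: "(\<integral>\<^sup>+z. indicator (cball z r) u * G z \<partial>lborel) = (\<integral>\<^sup>+y. ball_overlap r u y \<partial>sphere_measure)"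
    for u :: "real ^ 'n"
  proof -
    have "(\<integral>\<^sup>+z. indicator (cball z r) u * G z \<partial>lborel)
        = (\<integral>\<^sup>+z. (\<integral>\<^sup>+y. indicator (cball z r) u * indicator (cball z r) y \<partial>sphere_measure) \<partial>lborel)"
      unfolding G_def by (intro nn_integral_cong nn_integral_cmult[symmetric]) measurable
    also have "\<dots> = (\<integral>\<^sup>+y. (\<integral>\<^sup>+z. indicator (cball z r) u * indicator (cball z r) y \<partial>lborel) \<partial>sphere_measure)"
      by (rule Fubini'[symmetric]) measurable
    finally show ?thesis by (simp add: ball_overlap_eq_nn_integral)
  qed
  have mean: "(\<integral>\<^sup>+y. ball_overlap r u y \<partial>sphere_measure) = ?S" if "u \<in> sphere 0 1" for u :: "real ^ 'n"
    by (rule nn_integral_sphere_invariant) (use that in \<open>auto simp: ball_overlap_orthogonal\<close>)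
  \<comment> \<open>Only one of the two factors \<open>G\<close> is expanded; the remaining inner
    integral is the one computed in \<open>G_int\<close>.\<close>
  have GG: "(\<integral>\<^sup>+z. G z * G z \<partial>lborel) = ?S"
  proof -
    have "(\<integral>\<^sup>+z. G z * G z \<partial>lborel)
        = (\<integral>\<^sup>+z. (\<integral>\<^sup>+u. indicator (cball z r) u * G z \<partial>sphere_measure) \<partial>lborel)"
      by (intro nn_integral_cong) (simp add: G_def nn_integral_multc)
    also have "\<dots> = (\<integral>\<^sup>+u. (\<integral>\<^sup>+z. indicator (cball z r) u * G z \<partial>lborel) \<partial>sphere_measure)"
      by (rule Fubini'[symmetric]) measurable
    finally show ?thesis by (simp add: G_int sphere_energy_def)
  qed
  have FG: "(\<integral>\<^sup>+z. F z * G z \<partial>lborel) = N * ?S"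
  proof -
    have "(\<integral>\<^sup>+z. F z * G z \<partial>lborel) = (\<Sum>i\<in>I. (\<integral>\<^sup>+z. indicator (cball z r) (x i) * G z \<partial>lborel))"
      unfolding F_def by (simp add: sum_distrib_right nn_integral_sum)
    also have "\<dots> = (\<Sum>i\<in>I. ?S)"
      by (intro sum.cong refl) (simp only: G_int mean[OF x])
    also have "\<dots> = N * ?S" by (simp add: N_def)
    finally show ?thesis .
  qed
  have "2 * (N * N * ?S) = (\<integral>\<^sup>+z. 2 * (F z * (N * G z)) \<partial>lborel)"
  proof -
    have "2 * (F z * (N * G z)) = (2 * N) * (F z * G z)" for z
      by (simp only: ac_simps)
    then show ?thesis by (simp add: nn_integral_cmult FG mult.assoc)
  qed
  also have "\<dots> \<le> (\<integral>\<^sup>+z. F z * F z + (N * G z) * (N * G z) \<partial>lborel)"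
    by (intro nn_integral_mono two_mult_le_ennreal)
  also have "\<dots> = (\<Sum>i\<in>I. \<Sum>j\<in>I. ball_overlap r (x i) (x j)) + N * N * ?S"
  proof -
    have "(N * G z) * (N * G z) = (N * N) * (G z * G z)" for z
      by (simp only: ac_simps)
    then show ?thesis by (simp add: nn_integral_add nn_integral_cmult FF GG)
  qed
  finally have "N * N * ?S + N * N * ?S \<le> N * N * ?S + (\<Sum>i\<in>I. \<Sum>j\<in>I. ball_overlap r (x i) (x j))"
    by (simp add: mult_2 add.commute)
  moreover have "N * N * ?S \<noteq> \<top>"
    using sphere_energy_ball_overlap_finite[of r, where 'a = "real ^ 'n"]
    by (auto simp: N_def ennreal_mult_eq_top_iff ennreal_of_nat_eq_real_of_nat)
  ultimately have "N * N * ?S \<le> (\<Sum>i\<in>I. \<Sum>j\<in>I. ball_overlap r (x i) (x j))"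
    by (simp add: ennreal_add_left_cancel_le)
  then show ?thesis by (simp add: N_def power2_eq_square)
qed

text \<open>An overlap is at most the volume of one ball and vanishes beyond distance
  \<open>2 * r\<close>, so the potential is at most that volume times the measure of a cap of radius
  \<open>2 * r\<close>. The powers of two from the cap bound and from the doubled radius combine to
  \<open>4 ^ DIM('a)\<close>.\<close>

lemma sphere_energy_ball_overlap_le:
  assumes r: "r > 0"
  shows "sphere_energy (ball_overlap r :: 'a::euclidean_space \<Rightarrow> _)
    \<le> ennreal (unit_ball_vol DIM('a) * 4 ^ DIM('a) * r ^ (2 * DIM('a) - 1))"
proof -
  interpret prob_space "sphere_measure :: 'a measure"
    by (rule prob_space_sphere_measure)
  let ?V = "unit_ball_vol (real DIM('a))"
  obtain D where D: "DIM('a) = Suc D" using DIM_positive[where 'a='a] by (metis Suc_pred)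
  have "(\<integral>\<^sup>+y. ball_overlap r x y \<partial>sphere_measure) \<le> ennreal (?V * 4 ^ DIM('a) * r ^ (2 * DIM('a) - 1))"
    if x: "x \<in> sphere 0 1" for x :: 'a
  proof -
    have le: "ball_overlap r x y \<le> ennreal (?V * r ^ DIM('a)) * indicator (cball x (2 * r)) y" for y
      using ball_overlap_le_self[of r x y] ball_overlap_self[of r x] ball_overlap_eq_0[of r x y] r
      by (auto simp: indicator_def)
    have "(\<integral>\<^sup>+y. ball_overlap r x y \<partial>sphere_measure)
        \<le> (\<integral>\<^sup>+y. ennreal (?V * r ^ DIM('a)) * indicator (cball x (2 * r)) y \<partial>sphere_measure)"
      by (intro nn_integral_mono le)
    also have "\<dots> = ennreal (?V * r ^ DIM('a)) * emeasure sphere_measure (cball x (2 * r))"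
      by (intro nn_integral_cmult_indicator) auto
    also have "\<dots> \<le> ennreal (?V * r ^ DIM('a)) * ennreal (2 ^ (DIM('a) + 1) * (2 * r) ^ (DIM('a) - 1))"
      using x r by (intro mult_left_mono sphere_measure_cball_le) auto
    also have "\<dots> = ennreal (?V * r ^ DIM('a) * (2 ^ (DIM('a) + 1) * (2 * r) ^ (DIM('a) - 1)))"
      using r by (intro ennreal_mult[symmetric]) auto
    also have "?V * r ^ DIM('a) * (2 ^ (DIM('a) + 1) * (2 * r) ^ (DIM('a) - 1))
        = ?V * 4 ^ DIM('a) * r ^ (2 * DIM('a) - 1)"
    proof -
      have "(4::real) ^ Suc D = 2 ^ Suc D * 2 ^ Suc D"
        by (subst power_mult_distrib[symmetric]) simp
      moreover have "r ^ (2 * Suc D - 1) = r ^ Suc D * r ^ D"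
        by (subst power_add[symmetric]) (simp add: mult_2)
      ultimately show ?thesis
        by (simp only: D) (simp add: power_mult_distrib)
    qed
    finally show ?thesis .
  qed
  then have "sphere_energy (ball_overlap r :: 'a \<Rightarrow> _)
      \<le> (\<integral>\<^sup>+x. ennreal (?V * 4 ^ DIM('a) * r ^ (2 * DIM('a) - 1)) \<partial>(sphere_measure :: 'a measure))"
    unfolding sphere_energy_def using AE_sphere_measure[where 'a = 'a]
    by (intro nn_integral_mono_AE) auto
  also have "\<dots> = ennreal (?V * 4 ^ DIM('a) * r ^ (2 * DIM('a) - 1))"
    using emeasure_space_1 by simp
  finally show ?thesis .
qed

subsection \<open>Truncated Riesz kernels\<close>

text \<open>The Fefferman-de la Llave integral over radii above \<open>t\<close>. Under scaling, the
  overlap contributes the exponent \<open>DIM('a)\<close> and \<open>dr\<close> contributes 1, so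
  this weight makes the full integral \<open>t = 0\<close> homogeneous of degree
  \<open>- s\<close>.\<close>

definition riesz_tail :: "real \<Rightarrow> real \<Rightarrow> 'a::euclidean_space \<Rightarrow> 'a \<Rightarrow> ennreal" where
  "riesz_tail s t x y = (\<integral>\<^sup>+r. ball_overlap r x y *
     (ennreal (r powr (- s - DIM('a) - 1)) * indicator {t<..} r) \<partial>lborel)"

lemma borel_measurable_riesz_tail [measurable]:
  fixes g h :: "'b \<Rightarrow> 'a::euclidean_space"
  assumes [measurable]: "g \<in> borel_measurable M" "h \<in> borel_measurable M"
  shows "(\<lambda>p. riesz_tail s t (g p) (h p)) \<in> borel_measurable M"
  unfolding riesz_tail_def
  by (intro lborel.borel_measurable_nn_integral) (simp add: split_beta')

lemma riesz_tail_orthogonal: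
  fixes T :: "'a::euclidean_space \<Rightarrow> 'a"
  shows "orthogonal_transformation T \<Longrightarrow> riesz_tail s t (T x) (T y) = riesz_tail s t x y"
  by (simp add: riesz_tail_def ball_overlap_orthogonal)

lemma riesz_tail_commute: "riesz_tail s t x y = riesz_tail s t y x"
  by (simp add: riesz_tail_def ball_overlap_def Int_commute)

lemma riesz_tail_mono: "t \<le> t' \<Longrightarrow> riesz_tail s t' x y \<le> riesz_tail s t x y"
  unfolding riesz_tail_def
  by (intro nn_integral_mono mult_left_mono) (auto simp: indicator_def)

lemma riesz_tail_le_self:
  fixes x y z :: "'a::euclidean_space"
  shows "riesz_tail s t x y \<le> riesz_tail s t z z"
  unfolding riesz_tail_def
proof (intro nn_integral_mono mult_right_mono)
  show "ball_overlap r x y \<le> ball_overlap r z z" for r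
    using ball_overlap_le_self[of r x y] ball_overlap_self_eq[of r x z] by simp
qed simp

text \<open>On the diagonal the overlap is a whole ball, which leaves the integrand
  \<open>r powr (- s - 1)\<close> up to a constant. The result is the price of including
  self-interactions in a double sum.\<close>

lemma riesz_tail_self:
  fixes x :: "'a::euclidean_space"
  assumes s: "s > 0" and t: "t > 0"
  shows "riesz_tail s t x x = ennreal (unit_ball_vol DIM('a) * t powr (- s) / s)"
proof -
  let ?V = "unit_ball_vol (real DIM('a))"
  have "riesz_tail s t x x = (\<integral>\<^sup>+r. ennreal ?V * (ennreal (r powr (- s - 1)) * indicator {t<..} r) \<partial>lborel)"
    unfolding riesz_tail_def
  proof (rule nn_integral_cong)
    fix r :: real
    show "ball_overlap r x x * (ennreal (r powr (- s - DIM('a) - 1)) * indicator {t<..} r)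
        = ennreal ?V * (ennreal (r powr (- s - 1)) * indicator {t<..} r)"
    proof (cases "r > t")
      case True
      then have r: "r > 0" using t by simp
      have "r ^ DIM('a) * r powr (- s - DIM('a) - 1) = r powr (- s - 1)"
        using r by (simp add: powr_realpow[symmetric] powr_add[symmetric])
      then have eq: "?V * r ^ DIM('a) * r powr (- s - DIM('a) - 1) = ?V * r powr (- s - 1)"
        by (simp only: mult.assoc)
      have "ball_overlap r x x * ennreal (r powr (- s - DIM('a) - 1))
          = ennreal (?V * r ^ DIM('a) * r powr (- s - DIM('a) - 1))"
        using r by (subst ball_overlap_self) (auto intro!: ennreal_mult[symmetric])
      also have "\<dots> = ennreal ?V * ennreal (r powr (- s - 1))"
        unfolding eq by (intro ennreal_mult) auto
      finally show ?thesis using True by simp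
    qed simp
  qed
  also have "\<dots> = ennreal ?V * ennreal (t powr (- s) / s)"
    using nn_integral_powr_greaterThan[of "- s - 1" t] s t by (simp add: nn_integral_cmult)
  also have "\<dots> = ennreal (?V * t powr (- s) / s)"
    using s by (simp add: ennreal_mult[symmetric])
  finally show ?thesis .
qed

text \<open>Under the substitution of \<open>a * r\<close> for \<open>r\<close>, the factors from
  overlap, weight and \<open>dr\<close> multiply to \<open>a powr (- s)\<close>. The cut-off 0 is
  preserved by this scaling.\<close>

lemma riesz_tail_affine:
  fixes x y :: "'a::euclidean_space"
  assumes a: "a > 0"
  shows "riesz_tail s 0 (c + a *\<^sub>R x) (c + a *\<^sub>R y) = ennreal (a powr (- s)) * riesz_tail s 0 x y"
proof -
  define e where "e = - s - real DIM('a) - 1"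
  have "riesz_tail s 0 (c + a *\<^sub>R x) (c + a *\<^sub>R y)
     = ennreal a * (\<integral>\<^sup>+r. ball_overlap (a * r) (c + a *\<^sub>R x) (c + a *\<^sub>R y) *
         (ennreal ((a * r) powr e) * indicator {0<..} (a * r)) \<partial>lborel)"
    unfolding riesz_tail_def e_def[symmetric]
    using a by (subst nn_integral_real_affine[where c = a and t = 0]) auto
  also have "\<dots> = ennreal a * (\<integral>\<^sup>+r. ennreal (a ^ DIM('a) * a powr e) *
      (ball_overlap r x y * (ennreal (r powr e) * indicator {0<..} r)) \<partial>lborel)"
  proof -
    have "ball_overlap (a * r) (c + a *\<^sub>R x) (c + a *\<^sub>R y) * (ennreal ((a * r) powr e) * indicator {0<..} (a * r))
       = ennreal (a ^ DIM('a) * a powr e) * (ball_overlap r x y * (ennreal (r powr e) * indicator {0<..} r))"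
      for r :: real
    proof (cases "r > 0")
      case True
      have "ennreal ((a * r) powr e) = ennreal (a powr e) * ennreal (r powr e)"
        using a True by (simp add: powr_mult ennreal_mult)
      then show ?thesis
        using a True by (simp add: ball_overlap_affine ennreal_mult ac_simps)
    next
      case False
      then show ?thesis using a by (simp add: zero_less_mult_iff)
    qed
    then show ?thesis by simp
  qed
  also have "\<dots> = ennreal a * (ennreal (a ^ DIM('a) * a powr e) * riesz_tail s 0 x y)"
    unfolding riesz_tail_def e_def[symmetric] by (subst nn_integral_cmult) auto
  also have "\<dots> = ennreal (a * (a ^ DIM('a) * a powr e)) * riesz_tail s 0 x y"
    using a by (simp add: ennreal_mult mult.assoc)
  also have "a * (a ^ DIM('a) * a powr e) = a powr (1 + (real DIM('a) + e))"
    using a by (simp add: powr_add powr_realpow)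
  also have "1 + (real DIM('a) + e) = - s" by (simp add: e_def)
  finally show ?thesis .
qed

text \<open>Radii above 1 suffice: there the overlap contains a ball of radius
  \<open>r / 2\<close>.\<close>

lemma riesz_tail_pos:
  fixes x y :: "'a::euclidean_space"
  assumes s: "s > 0" and d: "dist x y \<le> 1"
  shows "riesz_tail s 0 x y > 0"
proof -
  let ?V = "unit_ball_vol (real DIM('a)) / 2 ^ DIM('a)"
  have V: "?V > 0" by simp
  have "(\<integral>\<^sup>+r. ennreal ?V * (ennreal (r powr (- s - 1)) * indicator {1<..} r) \<partial>lborel) \<le> riesz_tail s 0 x y"
    unfolding riesz_tail_def
  proof (rule nn_integral_mono)
    fix r :: real
    show "ennreal ?V * (ennreal (r powr (- s - 1)) * indicator {1<..} r)
       \<le> ball_overlap r x y * (ennreal (r powr (- s - DIM('a) - 1)) * indicator {0<..} r)"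
    proof (cases "r > 1")
      case True
      have "?V * r powr (- s - 1) = unit_ball_vol (real DIM('a)) * (r / 2) ^ DIM('a) * r powr (- s - DIM('a) - 1)"
        using True by (simp add: powr_realpow[symmetric] powr_add[symmetric] power_divide)
      then have "ennreal ?V * ennreal (r powr (- s - 1))
          = ennreal (unit_ball_vol (real DIM('a)) * (r / 2) ^ DIM('a)) * ennreal (r powr (- s - DIM('a) - 1))"
        using True V by (subst (1 2) ennreal_mult[symmetric]) auto
      also have "\<dots> \<le> ball_overlap r x y * ennreal (r powr (- s - DIM('a) - 1))"
        using d True by (intro mult_right_mono ball_overlap_ge) auto
      finally show ?thesis using True by simp
    qed simp
  qed
  moreover have "(\<integral>\<^sup>+r. ennreal ?V * (ennreal (r powr (- s - 1)) * indicator {1<..} r) \<partial>lborel)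
      = ennreal ?V * ennreal (1 / s)"
    using nn_integral_powr_greaterThan[of "- s - 1" 1] s by (simp add: nn_integral_cmult)
  moreover have "ennreal ?V * ennreal (1 / s) > 0"
    using s V by (simp add: ennreal_zero_less_mult_iff del: unit_ball_vol_pos)
  ultimately show ?thesis by (metis order_less_le_trans)
qed

text \<open>The full integral is invariant under rotations and translations and homogeneous of
  degree \<open>- s\<close>, so off the diagonal its value at one pair of distance 1 determines it.
  That value, positive and finite, is the constant \<open>k\<close>.\<close>

lemma riesz_tail_0_eq:
  assumes s: "s > 0"
  obtains k where "k > 0" "\<And>x y :: real ^ 'n. riesz_tail s 0 x y = ennreal k * riesz_kernel s x y"
proof -
  obtain e :: "real ^ 'n" where e: "norm e = 1"
    using vector_choose_size[of 1] by auto
  let ?K = "riesz_tail s 0 e 0"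
  have pos: "?K > 0" using s e by (intro riesz_tail_pos) auto
  \<comment> \<open>Balls of radius at most \<open>1/4\<close> around two points at distance 1 are
    disjoint, so this cut-off loses nothing, and the cut-off integral is bounded by its finite
    diagonal value.\<close>
  have "?K = riesz_tail s (1/4) e 0"
    unfolding riesz_tail_def
  proof (rule nn_integral_cong)
    fix r :: real
    show "ball_overlap r e 0 * (ennreal (r powr (- s - DIM(real ^ 'n) - 1)) * indicator {0<..} r)
        = ball_overlap r e 0 * (ennreal (r powr (- s - DIM(real ^ 'n) - 1)) * indicator {1/4<..} r)"
      using ball_overlap_eq_0[of r e 0] e by (auto simp: indicator_def)
  qed
  also have "\<dots> \<le> riesz_tail s (1/4) e e" by (rule riesz_tail_le_self)
  also have "\<dots> < \<infinity>" using s by (simp add: riesz_tail_self)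
  finally obtain k where k: "?K = ennreal k" "k \<ge> 0"
    by (cases ?K) auto
  have kpos: "k > 0" using pos k by simp
  have "riesz_tail s 0 x y = ennreal k * riesz_kernel s x y" for x y :: "real ^ 'n"
  proof (cases "x = y")
    case False
    \<comment> \<open>The pair \<open>x\<close>, \<open>y\<close> arises from \<open>e\<close>,
      \<open>0\<close> by a rotation taking \<open>e\<close> to \<open>u\<close>, scaling by
      \<open>a\<close> and translation by \<open>y\<close>.\<close>
    define a where "a = norm (x - y)"
    define u where "u = (x - y) /\<^sub>R a"
    have a: "a > 0" using False by (simp add: a_def)
    have u: "norm u = norm e" using False e by (simp add: u_def a_def)
    obtain T where T: "orthogonal_transformation T" "T e = u"
      using u[symmetric] by (rule orthogonal_transformation_exists)
    have T0: "T 0 = 0" using T(1) by (simp add: orthogonal_transformation_linear linear_0)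
    have x: "x = y + a *\<^sub>R u" using a by (simp add: u_def)
    have "riesz_tail s 0 x y = riesz_tail s 0 (y + a *\<^sub>R u) (y + a *\<^sub>R 0)"
      using x by simp
    also have "\<dots> = ennreal (a powr (- s)) * riesz_tail s 0 (T e) (T 0)"
      using a by (simp only: riesz_tail_affine T T0)
    also have "\<dots> = ennreal k * riesz_kernel s x y"
      using False by (simp add: riesz_tail_orthogonal[OF T(1)] k riesz_kernel_def a_def mult.commute)
    finally show ?thesis .
  next
    case True
    \<comment> \<open>Scaling by 2 gives $u = 2^{-s} u$ for the positive value $u$ on the diagonal, so it is infinite.\<close>
    let ?t = "riesz_tail s 0 x x"
    have "0 < ?t" using riesz_tail_le_self[of s 0 e 0 x] pos by (rule order_less_le_trans[rotated])
    have "?t = riesz_tail s 0 (- x + 2 *\<^sub>R x) (- x + 2 *\<^sub>R x)"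
      by (simp add: scaleR_2)
    also have "\<dots> = ennreal (2 powr (- s)) * ?t"
      by (rule riesz_tail_affine) simp
    finally have eq: "?t = ennreal (2 powr (- s)) * ?t" .
    have "?t = \<infinity>"
    proof (rule ccontr)
      assume "?t \<noteq> \<infinity>"
      then obtain v where v: "?t = ennreal v" "v \<ge> 0" by (cases ?t) auto
      then have "v > 0" using \<open>0 < ?t\<close> by simp
      have "v = 2 powr (- s) * v"
        using eq v by (simp add: ennreal_mult[symmetric])
      then have "2 powr (- s) = 1" using \<open>v > 0\<close> by simp
      then show False using s by simp
    qed
    then show ?thesis
      using True kpos by (simp add: riesz_kernel_def ennreal_mult_top)
  qed
  with kpos show ?thesis by (rule that)
qed

section \<open>Means and double sums of the truncated kernels\<close>

lemma sphere_energy_riesz_tail: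
  "sphere_energy (riesz_tail s t :: 'a::euclidean_space \<Rightarrow> _) =
     (\<integral>\<^sup>+r. sphere_energy (ball_overlap r :: 'a \<Rightarrow> _) *
       (ennreal (r powr (- s - DIM('a) - 1)) * indicator {t<..} r) \<partial>lborel)"
proof -
  interpret prob_space "sphere_measure :: 'a measure"
    by (rule prob_space_sphere_measure)
  interpret pair_sigma_finite lborel "sphere_measure :: 'a measure"
    by unfold_locales
  define w where "w r = ennreal (r powr (- s - DIM('a) - 1)) * indicator {t<..} r" for r
  have [measurable]: "w \<in> borel_measurable borel" unfolding w_def by measurable
  have "sphere_energy (riesz_tail s t :: 'a \<Rightarrow> _)
      = (\<integral>\<^sup>+x. \<integral>\<^sup>+y. \<integral>\<^sup>+r. ball_overlap r x y * w r \<partial>lborel \<partial>(sphere_measure :: 'a measure) \<partial>(sphere_measure :: 'a measure))"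
    by (simp add: sphere_energy_def riesz_tail_def w_def)
  also have "\<dots> = (\<integral>\<^sup>+x. \<integral>\<^sup>+r. \<integral>\<^sup>+y. ball_overlap r x y * w r \<partial>(sphere_measure :: 'a measure) \<partial>lborel \<partial>(sphere_measure :: 'a measure))"
    by (intro nn_integral_cong Fubini') measurable
  also have "\<dots> = (\<integral>\<^sup>+x. \<integral>\<^sup>+r. (\<integral>\<^sup>+y. ball_overlap r x y \<partial>(sphere_measure :: 'a measure)) * w r \<partial>lborel \<partial>(sphere_measure :: 'a measure))"
    by (intro nn_integral_cong nn_integral_multc) measurable
  also have "\<dots> = (\<integral>\<^sup>+r. \<integral>\<^sup>+x. (\<integral>\<^sup>+y. ball_overlap r x y \<partial>(sphere_measure :: 'a measure)) * w r \<partial>(sphere_measure :: 'a measure) \<partial>lborel)"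
    by (intro Fubini') measurable
  also have "\<dots> = (\<integral>\<^sup>+r. sphere_energy (ball_overlap r :: 'a \<Rightarrow> _) * w r \<partial>lborel)"
    unfolding sphere_energy_def by (intro nn_integral_cong nn_integral_multc) measurable
  finally show ?thesis by (simp add: w_def)
qed

lemma borel_measurable_sphere_energy_ball_overlap [measurable]:
  "(\<lambda>r. sphere_energy (ball_overlap r :: 'a::euclidean_space \<Rightarrow> _)) \<in> borel_measurable borel"
proof -
  interpret prob_space "sphere_measure :: 'a measure"
    by (rule prob_space_sphere_measure)
  show ?thesis unfolding sphere_energy_def by measurable
qed

text \<open>The inequality for overlaps holds at every radius and survives integration against the
  nonnegative weight.\<close>

lemma riesz_tail_sum_ge:
  fixes x :: "'i \<Rightarrow> real ^ 'n"
  assumes I: "finite I" and x: "\<And>i. i \<in> I \<Longrightarrow> x i \<in> sphere 0 1"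
  shows "of_nat (card I) ^ 2 * sphere_energy (riesz_tail s t :: real ^ 'n \<Rightarrow> _)
    \<le> (\<Sum>i\<in>I. \<Sum>j\<in>I. riesz_tail s t (x i) (x j))"
proof -
  define w where "w r = ennreal (r powr (- s - DIM(real ^ 'n) - 1)) * indicator {t<..} r" for r
  have [measurable]: "w \<in> borel_measurable borel" unfolding w_def by measurable
  have "of_nat (card I) ^ 2 * sphere_energy (riesz_tail s t :: real ^ 'n \<Rightarrow> _)
      = (\<integral>\<^sup>+r. (of_nat (card I) ^ 2 * sphere_energy (ball_overlap r :: real ^ 'n \<Rightarrow> _)) * w r \<partial>lborel)"
    unfolding sphere_energy_riesz_tail w_def[symmetric]
    by (subst nn_integral_cmult[symmetric]) (auto simp: mult.assoc)
  also have "\<dots> \<le> (\<integral>\<^sup>+r. (\<Sum>i\<in>I. \<Sum>j\<in>I. ball_overlap r (x i) (x j)) * w r \<partial>lborel)"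
    by (intro nn_integral_mono mult_right_mono ball_overlap_sum_ge I x) auto
  also have "\<dots> = (\<Sum>i\<in>I. \<Sum>j\<in>I. riesz_tail s t (x i) (x j))"
    unfolding riesz_tail_def w_def[symmetric] by (simp add: sum_distrib_right nn_integral_sum)
  finally show ?thesis .
qed

text \<open>The discarded radii \<open>r \<le> t\<close> contribute at most a constant times the
  integral of \<open>r powr (DIM('a) - 2 - s)\<close> over \<open>{0<..t}\<close>, which converges
  because \<open>s < DIM('a) - 1\<close>.\<close>

lemma sphere_energy_riesz_tail_0_le:
  fixes s :: real
  assumes s: "s < real DIM('a) - 1" and t: "t \<ge> 0"
  shows "sphere_energy (riesz_tail s 0 :: 'a::euclidean_space \<Rightarrow> _)
    \<le> sphere_energy (riesz_tail s t :: 'a \<Rightarrow> _)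
      + ennreal (unit_ball_vol DIM('a) * 4 ^ DIM('a) / (real DIM('a) - 1 - s) * t powr (real DIM('a) - 1 - s))"
proof -
  define e where "e = - s - real DIM('a) - 1"
  define E where "E r = sphere_energy (ball_overlap r :: 'a \<Rightarrow> _)" for r
  define V where "V = unit_ball_vol (real DIM('a)) * 4 ^ DIM('a)"
  have V: "V \<ge> 0" by (simp add: V_def)
  have [measurable]: "E \<in> borel_measurable borel" unfolding E_def by measurable
  have tail: "sphere_energy (riesz_tail s t :: 'a \<Rightarrow> _) = (\<integral>\<^sup>+r. E r * (ennreal (r powr e) * indicator {t<..} r) \<partial>lborel)" for t
    by (simp add: sphere_energy_riesz_tail e_def E_def)
  have "sphere_energy (riesz_tail s 0 :: 'a \<Rightarrow> _)
      = (\<integral>\<^sup>+r. E r * (ennreal (r powr e) * indicator {t<..} r) + E r * (ennreal (r powr e) * indicator {0<..t} r) \<partial>lborel)"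
    unfolding tail using t by (intro nn_integral_cong) (auto simp: indicator_def)
  also have "\<dots> = sphere_energy (riesz_tail s t :: 'a \<Rightarrow> _)
      + (\<integral>\<^sup>+r. E r * (ennreal (r powr e) * indicator {0<..t} r) \<partial>lborel)"
    unfolding tail by (intro nn_integral_add) auto
  also have "(\<integral>\<^sup>+r. E r * (ennreal (r powr e) * indicator {0<..t} r) \<partial>lborel)
      \<le> (\<integral>\<^sup>+r. ennreal V * (ennreal (r powr (real DIM('a) - 2 - s)) * indicator {0<..t} r) \<partial>lborel)"
  proof (rule nn_integral_mono)
    fix r :: real
    show "E r * (ennreal (r powr e) * indicator {0<..t} r)
        \<le> ennreal V * (ennreal (r powr (real DIM('a) - 2 - s)) * indicator {0<..t} r)"
    proof (cases "r \<in> {0<..t}")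
      case True
      then have r: "r > 0" by simp
      have "E r * ennreal (r powr e) \<le> ennreal (V * r ^ (2 * DIM('a) - 1)) * ennreal (r powr e)"
        unfolding E_def V_def using r by (intro mult_right_mono sphere_energy_ball_overlap_le) auto
      also have "\<dots> = ennreal (V * r ^ (2 * DIM('a) - 1) * r powr e)"
        using r V by (intro ennreal_mult[symmetric]) auto
      also have "V * r ^ (2 * DIM('a) - 1) * r powr e = V * r powr (real DIM('a) - 2 - s)"
      proof -
        have "real (2 * DIM('a) - 1) = 2 * real DIM('a) - 1"
          using DIM_positive[where 'a = 'a] by (simp add: of_nat_diff)
        then have "r ^ (2 * DIM('a) - 1) = r powr (2 * real DIM('a) - 1)"
          using powr_realpow[OF r, of "2 * DIM('a) - 1"] by simp
        then show ?thesis by (simp add: powr_add[symmetric] e_def mult.assoc algebra_simps)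
      qed
      also have "ennreal \<dots> = ennreal V * ennreal (r powr (real DIM('a) - 2 - s))"
        using V by (intro ennreal_mult) auto
      finally show ?thesis using True by simp
    qed simp
  qed
  also have "\<dots> = ennreal V * ennreal (t powr (real DIM('a) - 1 - s) / (real DIM('a) - 1 - s))"
  proof -
    have eq: "real DIM('a) - 1 - s = real DIM('a) - 2 - s + 1" by simp
    have "(\<integral>\<^sup>+r. ennreal (r powr (real DIM('a) - 2 - s)) * indicator {0<..t} r \<partial>lborel)
        = ennreal (t powr (real DIM('a) - 1 - s) / (real DIM('a) - 1 - s))"
      unfolding eq by (rule nn_integral_powr_greaterThanAtMost) (use s t in auto)
    then show ?thesis by (simp add: nn_integral_cmult)
  qed
  also have "\<dots> = ennreal (V / (real DIM('a) - 1 - s) * t powr (real DIM('a) - 1 - s))"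
    using s V by (simp add: ennreal_mult[symmetric])
  finally show ?thesis by (simp add: V_def)
qed

subsection \<open>Greedy sequences\<close>

lemma riesz_kernel_commute: "riesz_kernel s x y = riesz_kernel s y x"
  by (simp add: riesz_kernel_def norm_minus_commute)

lemma riesz_kernel_orthogonal:
  fixes T :: "'a::euclidean_space \<Rightarrow> 'a"
  assumes T: "orthogonal_transformation T"
  shows "riesz_kernel s (T x) (T y) = riesz_kernel s x y"
proof -
  have "norm (T x - T y) = norm (x - y)"
    using T orthogonal_transformation_norm[OF T, of "x - y"]
    by (simp add: orthogonal_transformation_linear linear_diff)
  moreover have "T x = T y \<longleftrightarrow> x = y"
    using orthogonal_transformation_inj[OF T] by (auto dest: injD)
  ultimately show ?thesis by (simp add: riesz_kernel_def)
qed

lemma borel_measurable_riesz_kernel: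
  assumes "s > 0"
  shows "riesz_kernel s x \<in> borel_measurable (borel :: 'a::euclidean_space measure)"
proof -
  have eq: "riesz_kernel s x = (\<lambda>y. riesz_kernel s y x)"
    by (intro ext riesz_kernel_commute)
  show ?thesis
    unfolding eq by (rule borel_measurable_continuous_onI[OF continuous_on_riesz_kernel[OF assms]])
qed

text \<open>A minimum is at most the average, and each point contributes the same average.
  Consequently deficits are nonnegative and, once the energy is finite, polarizations are
  finite.\<close>

lemma polarization_le_sphere_energy:
  fixes x :: "nat \<Rightarrow> real ^ 'n"
  assumes s: "s > 0" and x: "\<And>i. i \<ge> 1 \<Longrightarrow> x i \<in> sphere 0 1"
  shows "polarization (riesz_kernel s) x N \<le> of_nat N * sphere_energy (riesz_kernel s :: real ^ 'n \<Rightarrow> _)"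
proof -
  interpret prob_space "sphere_measure :: (real ^ 'n) measure"
    by (rule prob_space_sphere_measure)
  let ?P = "polarization (riesz_kernel s) x N"
  have [measurable]: "riesz_kernel s u \<in> borel_measurable borel" for u :: "real ^ 'n"
    using s by (rule borel_measurable_riesz_kernel)
  have "?P = (\<integral>\<^sup>+y. ?P \<partial>(sphere_measure :: (real ^ 'n) measure))"
    using emeasure_space_1 by simp
  also have "\<dots> \<le> (\<integral>\<^sup>+y. (\<Sum>i=1..N. riesz_kernel s (x i) y) \<partial>sphere_measure)"
  proof (rule nn_integral_mono_AE)
    show "AE y in sphere_measure. ?P \<le> (\<Sum>i=1..N. riesz_kernel s (x i) y)"
      using AE_sphere_measure
    proof eventually_elim
      case (elim y)
      then have "?P \<le> (\<Sum>i=1..N. riesz_kernel s y (x i))"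
        unfolding polarization_def by (rule INF_lower)
      then show ?case by (simp only: riesz_kernel_commute[of s y])
    qed
  qed
  also have "\<dots> = (\<Sum>i=1..N. \<integral>\<^sup>+y. riesz_kernel s (x i) y \<partial>sphere_measure)"
    by (intro nn_integral_sum) simp
  also have "\<dots> = (\<Sum>i=1..N. sphere_energy (riesz_kernel s :: real ^ 'n \<Rightarrow> _))"
    by (intro sum.cong refl nn_integral_sphere_invariant riesz_kernel_orthogonal x) auto
  finally show ?thesis by simp
qed

text \<open>The next greedy point attains the minimum defining the polarization, so that minimum is
  the interaction of the new point with all earlier ones.\<close>

lemma greedy_sequence_polarization:
  assumes "greedy_sequence K x"
  obtains m where "m \<ge> 1" "\<And>i. i \<ge> 1 \<Longrightarrow> x i \<in> sphere 0 1"
    "\<And>N. N \<ge> m \<Longrightarrow> polarization K x N = (\<Sum>i=1..N. K (x (Suc N)) (x i))"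
proof -
  obtain m where m: "m \<ge> 1" "\<And>i. i \<in> {1..m} \<Longrightarrow> x i \<in> sphere 0 1"
    and min: "\<And>N. N \<ge> m \<Longrightarrow>
      is_arg_min (\<lambda>y. \<Sum>i=1..N. K y (x i)) (\<lambda>y. y \<in> sphere 0 1) (x (Suc N))"
    using assms by (auto simp: greedy_sequence_def)
  have sph: "x i \<in> sphere 0 1" if "i \<ge> 1" for i
  proof (cases "i \<le> m")
    case True
    then show ?thesis using m that by simp
  next
    case False
    \<comment> \<open>For \<open>i > m\<close>, \<open>x i\<close> is the minimizer chosen after
      \<open>i - 1 \<ge> m\<close> points.\<close>
    then show ?thesis using min[of "i - 1"] that by (simp add: is_arg_min_def)
  qed
  have "polarization K x N = (\<Sum>i=1..N. K (x (Suc N)) (x i))" if "N \<ge> m" for N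
    unfolding polarization_def using min[OF that]
    by (intro antisym INF_lower INF_greatest) (auto simp: is_arg_min_linorder)
  with m(1) sph show ?thesis by (rule that)
qed

text \<open>A new point adds a row, an equal column by symmetry, and a diagonal entry. The initial
  \<open>m\<close> by \<open>m\<close> block, which no greedy condition controls, is bounded
  entrywise by \<open>T\<close>.\<close>

lemma double_sum_le_greedy:
  fixes F :: "nat \<Rightarrow> nat \<Rightarrow> ennreal"
  assumes sym: "\<And>i j. F i j = F j i" and bound: "\<And>i j. F i j \<le> T"
    and step: "\<And>j. j \<ge> m \<Longrightarrow> (\<Sum>i=1..j. F (Suc j) i) \<le> p j"
    and N: "m \<le> N"
  shows "(\<Sum>i=1..N. \<Sum>j=1..N. F i j) \<le> of_nat (m ^ 2) * T + (\<Sum>j=m..<N. 2 * p j + T)"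
  using N
proof (induction N rule: dec_induct)
  case base
  have "(\<Sum>i=1..m. \<Sum>j=1..m. F i j) \<le> (\<Sum>i=1..m. \<Sum>j=1..m. T)"
    by (intro sum_mono bound)
  then show ?case by (simp add: power2_eq_square mult.assoc)
next
  case (step N)
  have col: "(\<Sum>i=1..N. F i (Suc N)) = (\<Sum>i=1..N. F (Suc N) i)"
    by (intro sum.cong refl sym)
  have "(\<Sum>i=1..Suc N. \<Sum>j=1..Suc N. F i j)
      = (\<Sum>i=1..N. \<Sum>j=1..N. F i j) + (2 * (\<Sum>i=1..N. F (Suc N) i) + F (Suc N) (Suc N))"
    by (simp add: sum.distrib mult_2 col[simplified] add.assoc)
  also have "\<dots> \<le> (of_nat (m ^ 2) * T + (\<Sum>j=m..<N. 2 * p j + T)) + (2 * p N + T)"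
    using step.hyps by (intro add_mono step.IH mult_left_mono bound assms(3)) auto
  also have "\<dots> = of_nat (m ^ 2) * T + (\<Sum>j=m..<Suc N. 2 * p j + T)"
    using step.hyps by (simp add: add.assoc)
  finally show ?case .
qed

section \<open>Counting the indices with a large deficit\<close>

text \<open>A Markov-type bound. Indices up to \<open>\<delta> * N\<close> are given away; on the
  others \<open>j powr a\<close> is at least \<open>(\<delta> * N) powr a\<close>, so each bad index
  uses up a fixed share of the total deficit.\<close>

lemma card_deficit_le:
  fixes D :: "nat \<Rightarrow> real"
  assumes nonneg: "\<And>j. 0 \<le> D j" and C: "C > 0" and a: "a \<ge> 0" and eps: "\<epsilon> > 0"
    and sum_le: "\<And>N. N \<ge> M \<Longrightarrow> (\<Sum>j=m..<N. D j) \<le> C * real N powr (1 + a)"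
  shows "\<forall>\<^sub>F N in sequentially.
    real (card {j \<in> {1..N}. D j \<le> C / (\<epsilon> / 4 * (\<epsilon> / 4) powr a) * real j powr a}) \<ge> (1 - \<epsilon>) * real N"
proof -
  define \<delta> where "\<delta> = \<epsilon> / 4"
  have \<delta>: "\<delta> > 0" using eps by (simp add: \<delta>_def)
  \<comment> \<open>Solves \<open>C * N powr (1 + a) = \<delta> * N * (X * (\<delta> * N) powr
    a)\<close>, so that at most \<open>\<delta> * N\<close> indices remain in
    \<open>?B\<close>.\<close>
  define X where "X = C / (\<delta> * \<delta> powr a)"
  have X: "X > 0" using C \<delta> by (simp add: X_def)
  have main: "(1 - \<epsilon>) * real N \<le> real (card {j \<in> {1..N}. D j \<le> X * real j powr a})"
    if N: "N \<ge> M" "N \<ge> 1" "real N \<ge> real (m + 1) / (2 * \<delta>)" for N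
  proof -
    let ?good = "{j \<in> {1..N}. D j \<le> X * real j powr a}"
    let ?bad = "{j \<in> {1..N}. \<not> D j \<le> X * real j powr a}"
    \<comment> \<open>The index \<open>N\<close> is set aside, like those below \<open>m\<close>,
      because the deficit sum runs over \<open>m \<le> j < N\<close>.\<close>
    let ?B = "{j \<in> {m..<N}. \<delta> * real N < real j \<and> \<not> D j \<le> X * real j powr a}"
    have "?bad \<subseteq> {1..nat \<lfloor>\<delta> * real N\<rfloor>} \<union> (insert N {..<m} \<union> ?B)"
    proof
      fix j assume j: "j \<in> ?bad"
      show "j \<in> {1..nat \<lfloor>\<delta> * real N\<rfloor>} \<union> (insert N {..<m} \<union> ?B)"
      proof (cases "real j \<le> \<delta> * real N")
        case True
        then have "j \<le> nat \<lfloor>\<delta> * real N\<rfloor>" by (rule le_nat_floor)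
        then show ?thesis using j by simp
      next
        case False
        then show ?thesis using j by auto
      qed
    qed
    then have "card ?bad \<le> card ({1..nat \<lfloor>\<delta> * real N\<rfloor>} \<union> (insert N {..<m} \<union> ?B))"
      by (intro card_mono) auto
    also have "\<dots> \<le> card {1..nat \<lfloor>\<delta> * real N\<rfloor>} + (card (insert N {..<m}) + card ?B)"
      by (meson add_left_mono card_Un_le le_trans)
    also have "card (insert N {..<m}) \<le> m + 1"
      by (simp add: card_insert_if)
    finally have "card ?bad \<le> nat \<lfloor>\<delta> * real N\<rfloor> + (m + 1 + card ?B)" by simp
    then have "real (card ?bad) \<le> real (nat \<lfloor>\<delta> * real N\<rfloor>) + (real (m + 1) + real (card ?B))"
      unfolding of_nat_add[symmetric] of_nat_le_iff .
    also have "real (nat \<lfloor>\<delta> * real N\<rfloor>) \<le> \<delta> * real N"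
      using \<delta> by (intro of_nat_floor) simp
    finally have bad: "real (card ?bad) \<le> \<delta> * real N + (real (m + 1) + real (card ?B))"
      by simp
    have "real (card ?B) * (X * (\<delta> * real N) powr a) = (\<Sum>j\<in>?B. X * (\<delta> * real N) powr a)"
      by simp
    also have "\<dots> \<le> (\<Sum>j\<in>?B. D j)"
    proof (rule sum_mono)
      fix j assume j: "j \<in> ?B"
      then have "X * (\<delta> * real N) powr a \<le> X * real j powr a"
        using X \<delta> a by (intro mult_left_mono powr_mono2) auto
      then show "X * (\<delta> * real N) powr a \<le> D j" using j by simp
    qed
    also have "\<dots> \<le> (\<Sum>j=m..<N. D j)"
      using nonneg by (intro sum_mono2) auto
    also have "\<dots> \<le> C * real N powr (1 + a)"
      using N by (intro sum_le)
    also have "\<dots> = \<delta> * real N * (X * (\<delta> * real N) powr a)"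
    proof -
      have "X * \<delta> powr a * \<delta> = C" using \<delta> by (simp add: X_def)
      then have "\<delta> * real N * (X * (\<delta> powr a * real N powr a)) = C * (real N * real N powr a)"
        by (metis mult.assoc mult.commute)
      then show ?thesis using N \<delta> by (simp add: powr_add powr_mult)
    qed
    finally have "real (card ?B) \<le> \<delta> * real N"
      using X \<delta> N by simp
    \<comment> \<open>The budget is \<open>\<delta> * N\<close> for small indices,
      \<open>2 * \<delta> * N\<close> for those below \<open>m\<close> and \<open>N\<close> itself,
      and \<open>\<delta> * N\<close> for \<open>?B\<close>: four times \<open>\<delta>\<close>,
      hence \<open>\<epsilon>\<close>.\<close>
    moreover have "real (m + 1) \<le> 2 * \<delta> * real N"
      using N(3) \<delta> by (simp add: field_simps)
    ultimately have bad_le: "real (card ?bad) \<le> \<epsilon> * real N"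
      using bad by (simp add: \<delta>_def)
    have "card ?good + card ?bad = N"
    proof -
      have union: "?good \<union> ?bad = {1..N}" by auto
      have "card (?good \<union> ?bad) = card ?good + card ?bad"
        by (intro card_Un_disjoint) auto
      then show ?thesis unfolding union by simp
    qed
    then have "real (card ?good) + real (card ?bad) = real N"
      by (simp only: of_nat_add[symmetric])
    then show ?thesis using bad_le unfolding left_diff_distrib by linarith
  qed
  have "\<forall>\<^sub>F N in sequentially. real N \<ge> real (m + 1) / (2 * \<delta>)"
    using filterlim_real_sequentially unfolding filterlim_at_top by blast
  then have "\<forall>\<^sub>F N in sequentially. (1 - \<epsilon>) * real N \<le> real (card {j \<in> {1..N}. D j \<le> X * real j powr a})"
    using eventually_ge_at_top[of M] eventually_ge_at_top[of 1]
    by eventually_elim (rule main)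
  then show ?thesis
    by (simp only: X_def \<delta>_def)
qed

section \<open>The total deficit along a greedy sequence\<close>

text \<open>The truncated energy of the first \<open>N\<close> points is bounded below by positive
  definiteness and above by the polarizations. \<open>C\<close> is fixed before the sequence; only
  \<open>m\<close> and \<open>M\<close> depend on it.\<close>

lemma greedy_deficit_sum_le:
  fixes s :: real and d :: nat
  assumes d: "CARD('n::finite) = d + 1" and s: "0 < s" "s < real d"
  obtains C where "C > 0" "sphere_energy (riesz_kernel s :: real ^ 'n \<Rightarrow> _) < \<infinity>"
    "\<And>x :: nat \<Rightarrow> real ^ 'n. greedy_sequence (riesz_kernel s) x \<Longrightarrow>
      \<exists>m M. \<forall>N\<ge>M. (\<Sum>j=m..<N. real j * enn2real (sphere_energy (riesz_kernel s :: real ^ 'n \<Rightarrow> _))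
        - enn2real (polarization (riesz_kernel s) x j)) \<le> C * real N powr (1 + s / real d)"
proof -
  have DIM: "DIM(real ^ 'n) = d + 1" using d by simp
  obtain k where k: "k > 0"
    and tail0: "\<And>x y :: real ^ 'n. riesz_tail s 0 x y = ennreal k * riesz_kernel s x y"
    using riesz_tail_0_eq[OF s(1), where 'n = 'n] by metis
  \<comment> \<open>\<open>C1\<close> measures the mean lost by the cut-off, \<open>C2\<close> the
    size of the diagonal.\<close>
  define C1 where "C1 = unit_ball_vol (real d + 1) * 4 ^ (d + 1) / (real d - s)"
  define C2 where "C2 = unit_ball_vol (real d + 1) / s"
  have C1: "C1 > 0" and C2: "C2 > 0" using s by (auto simp: C1_def C2_def)
  define I where "I = sphere_energy (riesz_kernel s :: real ^ 'n \<Rightarrow> _)"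
  define E where "E t = sphere_energy (riesz_tail s t :: real ^ 'n \<Rightarrow> _)" for t
  interpret prob_space "sphere_measure :: (real ^ 'n) measure"
    by (rule prob_space_sphere_measure)
  have kernel_meas[measurable]: "riesz_kernel s u \<in> borel_measurable borel" for u :: "real ^ 'n"
    using s(1) by (rule borel_measurable_riesz_kernel)
  have tail_self: "riesz_tail s t u v \<le> ennreal (C2 * t powr (- s))" if "t > 0" for t and u v :: "real ^ 'n"
  proof -
    have "riesz_tail s t u v \<le> riesz_tail s t u u" by (rule riesz_tail_le_self)
    also have "\<dots> = ennreal (C2 * t powr (- s))"
      unfolding riesz_tail_self[OF s(1) that] DIM by (simp add: C2_def add.commute)
    finally show ?thesis .
  qed
  have E0: "E 0 = ennreal k * I"
  proof -
    have "(\<integral>\<^sup>+x. ennreal k * (\<integral>\<^sup>+y. riesz_kernel s x y \<partial>sphere_measure) \<partial>(sphere_measure :: (real ^ 'n) measure))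
        = ennreal k * I"
      unfolding I_def sphere_energy_def
    proof (rule nn_integral_cmult)
      \<comment> \<open>Measurability of the Riesz potential is inherited from the tail kernel at
        cut-off 0, which is \<open>k\<close> times the Riesz kernel.\<close>
      have "(\<lambda>x. ennreal (1 / k) * (\<integral>\<^sup>+y. riesz_tail s 0 x y \<partial>sphere_measure)) \<in> borel_measurable (sphere_measure :: (real ^ 'n) measure)"
        by measurable
      moreover have "ennreal (1 / k) * (\<integral>\<^sup>+y. riesz_tail s 0 x y \<partial>sphere_measure) = (\<integral>\<^sup>+y. riesz_kernel s x y \<partial>sphere_measure)"
        for x :: "real ^ 'n"
        using k by (simp add: tail0 nn_integral_cmult mult.assoc[symmetric] ennreal_mult[symmetric])
      ultimately show "(\<lambda>x. \<integral>\<^sup>+y. riesz_kernel s x y \<partial>sphere_measure) \<in> borel_measurable (sphere_measure :: (real ^ 'n) measure)"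
        by simp
    qed
    then show ?thesis
      by (simp add: E_def sphere_energy_def tail0 nn_integral_cmult)
  qed
  have E_le: "E t \<le> ennreal (C2 * t powr (- s))" if "t > 0" for t
  proof -
    have "E t \<le> (\<integral>\<^sup>+x. \<integral>\<^sup>+y. ennreal (C2 * t powr (- s)) \<partial>(sphere_measure :: (real ^ 'n) measure) \<partial>(sphere_measure :: (real ^ 'n) measure))"
      unfolding E_def sphere_energy_def by (intro nn_integral_mono tail_self that)
    then show ?thesis using emeasure_space_1 by simp
  qed
  have E0_le: "E 0 \<le> E t + ennreal (C1 * t powr (real d - s))" if "t \<ge> 0" for t
    using sphere_energy_riesz_tail_0_le[of s t, where 'a = "real ^ 'n"] s that
    unfolding DIM E_def C1_def by (simp add: add.commute)
  \<comment> \<open>Cutting at radius 1 shows that the energy is finite.\<close>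
  have "E 0 \<le> ennreal (C2 * 1 powr (- s)) + ennreal (C1 * 1 powr (real d - s))"
    using E0_le[of 1] E_le[of 1] by (meson add_right_mono order_trans zero_le_one zero_less_one)
  also have "\<dots> < \<infinity>" by simp
  finally have I_fin: "I < \<infinity>"
    using k by (auto simp: E0 ennreal_mult_less_top)
  define i where "i = enn2real I"
  have i: "I = ennreal i" "i \<ge> 0" using I_fin by (auto simp: i_def)
  show ?thesis
  proof (rule that[of "(C1 + 2 * C2) / (2 * k)"])
    show "(C1 + 2 * C2) / (2 * k) > 0" using C1 C2 k by simp
    show "sphere_energy (riesz_kernel s :: real ^ 'n \<Rightarrow> _) < \<infinity>"
      using I_fin by (simp add: I_def)
    fix x :: "nat \<Rightarrow> real ^ 'n" assume "greedy_sequence (riesz_kernel s) x"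
    then obtain m where m: "m \<ge> 1" and sph: "\<And>i. i \<ge> 1 \<Longrightarrow> x i \<in> sphere 0 1"
      and pol: "\<And>N. N \<ge> m \<Longrightarrow> polarization (riesz_kernel s) x N = (\<Sum>i=1..N. riesz_kernel s (x (Suc N)) (x i))"
      by (rule greedy_sequence_polarization) blast
    define p where "p j = enn2real (polarization (riesz_kernel s) x j)" for j
    have p: "polarization (riesz_kernel s) x j = ennreal (p j)" for j
    proof -
      have "polarization (riesz_kernel s) x j \<le> of_nat j * I"
        unfolding I_def using s(1) sph by (rule polarization_le_sphere_energy)
      also have "\<dots> < \<infinity>"
        using I_fin by (simp add: ennreal_mult_less_top ennreal_of_nat_eq_real_of_nat)
      finally show ?thesis by (simp add: p_def)
    qed
    have p0: "p j \<ge> 0" for j by (simp add: p_def)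
    \<comment> \<open>The bound \<open>N \<ge> m ^ 2\<close> lets the initial block
      \<open>m ^ 2 * T\<close> be absorbed into \<open>N * T\<close>.\<close>
    have "(\<Sum>j=m..<N. real j * i - p j) \<le> (C1 + 2 * C2) / (2 * k) * real N powr (1 + s / real d)"
      if N: "N \<ge> m ^ 2" for N
    proof -
      have "m \<le> m ^ 2" using m by (simp add: power2_eq_square)
      then have mN: "m \<le> N" "N \<ge> 1" using N m by auto
      define n where "n = real N"
      have n: "n \<ge> 1" using mN by (simp add: n_def)
      have d0: "real d > 0" using s by simp
      \<comment> \<open>This radius balances the two errors: \<open>n * t powr (- s)\<close> and
        \<open>n ^ 2 * t powr (d - s)\<close> both equal \<open>n powr (1 + s / d)\<close>.\<close>
      define t where "t = n powr (- 1 / real d)"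
      have t: "t > 0" using n by (simp add: t_def)
      define T where "T = C2 * n powr (s / real d)"
      have T0: "T \<ge> 0" using C2 by (simp add: T_def)
      have T: "riesz_tail s t u v \<le> ennreal T" for u v :: "real ^ 'n"
        using tail_self[OF t, of u v] by (simp add: T_def t_def powr_powr)
      define e where "e = enn2real (E t)"
      have e: "E t = ennreal e" "e \<ge> 0"
        using le_less_trans[OF E_le[OF t], of \<infinity>] by (auto simp: e_def)
      have "ennreal (k * i) \<le> ennreal (e + C1 * t powr (real d - s))"
        using E0_le[of t] t k i C1 e by (simp add: E0 ennreal_mult)
      then have ki: "k * i \<le> e + C1 * t powr (real d - s)"
        using e C1 by (subst (asm) ennreal_le_iff) (auto intro: add_nonneg_nonneg)
      have "of_nat (card {1..N}) ^ 2 * E t \<le> (\<Sum>i=1..N. \<Sum>j=1..N. riesz_tail s t (x i) (x j))"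
        unfolding E_def by (rule riesz_tail_sum_ge) (use sph in auto)
      also have "\<dots> \<le> of_nat (m ^ 2) * ennreal T + (\<Sum>j=m..<N. 2 * ennreal (k * p j) + ennreal T)"
      proof (rule double_sum_le_greedy[OF riesz_tail_commute T _ mN(1)])
        fix j assume j: "j \<ge> m"
        \<comment> \<open>Restoring the small radii only increases the row, and the full row is
          \<open>k\<close> times the polarization.\<close>
        have "(\<Sum>i=1..j. riesz_tail s t (x (Suc j)) (x i)) \<le> (\<Sum>i=1..j. riesz_tail s 0 (x (Suc j)) (x i))"
          using t by (intro sum_mono riesz_tail_mono) simp
        also have "\<dots> = ennreal k * ennreal (p j)"
          by (simp only: tail0 sum_distrib_left[symmetric] pol[OF j, symmetric] p)
        also have "\<dots> = ennreal (k * p j)"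
          using k p0 by (simp add: ennreal_mult)
        finally show "(\<Sum>i=1..j. riesz_tail s t (x (Suc j)) (x i)) \<le> ennreal (k * p j)" .
      qed
      also have "(\<Sum>j=m..<N. 2 * ennreal (k * p j) + ennreal T) = (\<Sum>j=m..<N. ennreal (2 * (k * p j) + T))"
      proof (rule sum.cong[OF refl])
        fix j
        have "2 * ennreal (k * p j) = ennreal (2 * (k * p j))"
          using k p0 by (subst ennreal_mult) auto
        then show "2 * ennreal (k * p j) + ennreal T = ennreal (2 * (k * p j) + T)"
          using k p0 T0 by (simp add: ennreal_plus)
      qed
      also have "\<dots> = ennreal (\<Sum>j=m..<N. 2 * (k * p j) + T)"
        using k p0 T0 by (intro sum_ennreal) auto
      also have "of_nat (m ^ 2) * ennreal T = ennreal (real (m ^ 2) * T)"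
        using T0 unfolding ennreal_of_nat_eq_real_of_nat by (intro ennreal_mult[symmetric]) auto
      also have "ennreal (real (m ^ 2) * T) + ennreal (\<Sum>j=m..<N. 2 * (k * p j) + T)
          = ennreal (real (m ^ 2) * T + (\<Sum>j=m..<N. 2 * (k * p j) + T))"
        using k p0 T0 by (intro ennreal_plus[symmetric] sum_nonneg) auto
      also have "of_nat (card {1..N}) ^ 2 * E t = ennreal (n ^ 2 * e)"
        using e(2) unfolding e(1) n_def ennreal_of_nat_eq_real_of_nat
        by (simp add: ennreal_power ennreal_mult)
      finally have "ennreal (n ^ 2 * e) \<le> ennreal (real (m ^ 2) * T + (\<Sum>j=m..<N. 2 * (k * p j) + T))" .
      then have "n ^ 2 * e \<le> real (m ^ 2) * T + (\<Sum>j=m..<N. 2 * (k * p j) + T)"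
        using T0 k p0 by (subst (asm) ennreal_le_iff) (auto intro!: add_nonneg_nonneg sum_nonneg)
      also have "\<dots> = real (m ^ 2) * T + real (N - m) * T + 2 * k * (\<Sum>j=m..<N. p j)"
        by (simp add: sum.distrib sum_distrib_left mult.assoc)
      also have "\<dots> \<le> n * T + n * T + 2 * k * (\<Sum>j=m..<N. p j)"
      proof -
        have "real (m ^ 2) \<le> n" unfolding n_def of_nat_le_iff by (rule N)
        moreover have "real (N - m) \<le> n" by (simp add: n_def)
        ultimately show ?thesis
          using T0 by (intro add_right_mono add_mono mult_right_mono)
      qed
      finally have low: "n ^ 2 * e \<le> 2 * (n * T) + 2 * k * (\<Sum>j=m..<N. p j)" by linarith
      have nT: "n * T = C2 * n powr (1 + s / real d)"
        using n by (simp add: T_def powr_add)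
      have "t powr (real d - s) = n powr (s / real d - 1)"
        using d0 by (simp add: t_def powr_powr diff_divide_distrib)
      then have "n ^ 2 * (C1 * t powr (real d - s)) = C1 * (n powr 2 * n powr (s / real d - 1))"
        using n by (simp add: powr_numeral)
      also have "\<dots> = C1 * n powr (1 + s / real d)"
        by (simp add: powr_add[symmetric])
      finally have nC: "n ^ 2 * (C1 * t powr (real d - s)) = C1 * n powr (1 + s / real d)" .
      have "n ^ 2 * (k * i) \<le> n ^ 2 * (e + C1 * t powr (real d - s))"
        using ki by (intro mult_left_mono) auto
      also have "\<dots> \<le> 2 * (n * T) + 2 * k * (\<Sum>j=m..<N. p j) + C1 * n powr (1 + s / real d)"
        using low by (simp add: distrib_left nC)
      finally have up: "n ^ 2 * (k * i) \<le> 2 * k * (\<Sum>j=m..<N. p j) + (C1 + 2 * C2) * n powr (1 + s / real d)"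
        by (simp add: nT distrib_right)
      \<comment> \<open>Twice the sum of the means \<open>j * i\<close> is thus at most
        \<open>n ^ 2 * i\<close>, the leading term of the energy bound, and the two cancel.\<close>
      have "(\<Sum>j=m..<N. real j) \<le> (\<Sum>j<N. real j)"
        by (intro sum_mono2) auto
      also have "\<dots> \<le> n ^ 2 / 2"
        unfolding n_def by (induction N) (auto simp: power2_eq_square field_simps)
      finally have gauss: "2 * (\<Sum>j=m..<N. real j) \<le> n ^ 2" by simp
      have "2 * k * (\<Sum>j=m..<N. real j * i - p j) = k * i * (2 * (\<Sum>j=m..<N. real j)) - 2 * k * (\<Sum>j=m..<N. p j)"
        unfolding sum_subtractf sum_distrib_right[symmetric] by algebra
      also have "\<dots> \<le> k * i * n ^ 2 - 2 * k * (\<Sum>j=m..<N. p j)"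
        using gauss k i by (intro diff_right_mono mult_left_mono) auto
      also have "\<dots> \<le> (C1 + 2 * C2) * n powr (1 + s / real d)"
        using up by (simp add: mult.commute)
      finally have "(\<Sum>j=m..<N. real j * i - p j) \<le> (C1 + 2 * C2) * n powr (1 + s / real d) / (2 * k)"
        using k by (simp add: field_simps)
      then show ?thesis by (simp add: n_def)
    qed
    then show "\<exists>m M. \<forall>N\<ge>M. (\<Sum>j=m..<N. real j * enn2real (sphere_energy (riesz_kernel s :: real ^ 'n \<Rightarrow> _))
        - enn2real (polarization (riesz_kernel s) x j)) \<le> (C1 + 2 * C2) / (2 * k) * real N powr (1 + s / real d)"
      unfolding p_def i_def I_def by blast
  qed
qed

text \<open>The comparison is made in \<open>ereal\<close>, where the difference on the right is a
  genuine one and may be negative. \<open>X\<close> is quantified before \<open>x\<close>, hence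
  uniform over greedy sequences.\<close>

theorem corollary2p3:
  fixes s :: real and d :: nat
  assumes "CARD('n::finite) = d + 1" and "d \<ge> 2" and "0 < s" and "s < real d"
  shows "\<forall>\<epsilon>>0. \<exists>X>0. \<forall>x :: nat \<Rightarrow> real ^ 'n. greedy_sequence (riesz_kernel s) x \<longrightarrow>
    (\<forall>\<^sub>F N in sequentially.
      real (card {j \<in> {1..N}.
        enn2ereal (polarization (riesz_kernel s) x j) \<ge>
          ereal (real j) * enn2ereal (sphere_energy (riesz_kernel s :: real ^ 'n \<Rightarrow> real ^ 'n \<Rightarrow> ennreal))
          - ereal (X * real j powr (s / real d))})
      \<ge> (1 - \<epsilon>) * real N)"
proof (intro allI impI)
  fix \<epsilon> :: real assume eps: "\<epsilon> > 0"
  define I where "I = sphere_energy (riesz_kernel s :: real ^ 'n \<Rightarrow> real ^ 'n \<Rightarrow> ennreal)"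
  obtain C where C: "C > 0" and I_fin: "I < \<infinity>"
    and sum_le: "\<And>x :: nat \<Rightarrow> real ^ 'n. greedy_sequence (riesz_kernel s) x \<Longrightarrow>
      \<exists>m M. \<forall>N\<ge>M. (\<Sum>j=m..<N. real j * enn2real I - enn2real (polarization (riesz_kernel s) x j))
        \<le> C * real N powr (1 + s / real d)"
    unfolding I_def by (rule greedy_deficit_sum_le[OF assms(1,3,4)]) blast
  define i where "i = enn2real I"
  have i: "I = ennreal i" "i \<ge> 0" using I_fin by (auto simp: i_def)
  \<comment> \<open>The threshold of \<open>card_deficit_le\<close> for \<open>a = s / d\<close>; it
    is built from \<open>C\<close> and \<open>\<epsilon>\<close> before any sequence is
    fixed.\<close>
  define X where "X = C / (\<epsilon> / 4 * (\<epsilon> / 4) powr (s / real d))"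
  show "\<exists>X>0. \<forall>x :: nat \<Rightarrow> real ^ 'n. greedy_sequence (riesz_kernel s) x \<longrightarrow>
    (\<forall>\<^sub>F N in sequentially.
      real (card {j \<in> {1..N}.
        enn2ereal (polarization (riesz_kernel s) x j) \<ge>
          ereal (real j) * enn2ereal (sphere_energy (riesz_kernel s :: real ^ 'n \<Rightarrow> real ^ 'n \<Rightarrow> ennreal))
          - ereal (X * real j powr (s / real d))})
      \<ge> (1 - \<epsilon>) * real N)"
    unfolding I_def[symmetric]
  proof (intro exI[of _ X] conjI allI impI)
    show "X > 0" using C eps by (simp add: X_def)
    fix x :: "nat \<Rightarrow> real ^ 'n" assume greedy: "greedy_sequence (riesz_kernel s) x"
    then have sph: "\<And>i. i \<ge> 1 \<Longrightarrow> x i \<in> sphere 0 1"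
      by (rule greedy_sequence_polarization) blast
    define p where "p j = enn2real (polarization (riesz_kernel s) x j)" for j
    have pI: "polarization (riesz_kernel s) x j \<le> ennreal (real j * i)" for j
      using polarization_le_sphere_energy[OF assms(3) sph, where N = j] i
      by (simp add: I_def[symmetric] ennreal_mult ennreal_of_nat_eq_real_of_nat)
    have p: "polarization (riesz_kernel s) x j = ennreal (p j)" for j
      using le_less_trans[OF pI[of j], of \<infinity>] by (simp add: p_def)
    have le: "0 \<le> real j * i - p j" for j
      using pI[of j] i unfolding p by (simp add: ennreal_le_iff)
    obtain m M where mM: "\<And>N. N \<ge> M \<Longrightarrow> (\<Sum>j=m..<N. real j * i - p j) \<le> C * real N powr (1 + s / real d)"
      using sum_le[OF greedy] unfolding i_def p_def by blast
    \<comment> \<open>Energy and polarization are finite, so the extended inequality is one between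
      reals: the deficit is at most \<open>X * j powr (s / d)\<close>.\<close>
    have iff: "ereal (real j) * enn2ereal I - ereal (X * real j powr (s / real d)) \<le> enn2ereal (polarization (riesz_kernel s) x j)
        \<longleftrightarrow> real j * i - p j \<le> X * real j powr (s / real d)" for j
    proof -
      have "p j \<ge> 0" by (simp add: p_def)
      then show ?thesis using i by (simp add: p enn2ereal_ennreal) linarith
    qed
    show "\<forall>\<^sub>F N in sequentially.
      real (card {j \<in> {1..N}.
        enn2ereal (polarization (riesz_kernel s) x j) \<ge>
          ereal (real j) * enn2ereal I - ereal (X * real j powr (s / real d))})
      \<ge> (1 - \<epsilon>) * real N"
      unfolding iff unfolding X_def
      by (rule card_deficit_le[OF le C _ eps mM]) (use assms in auto)
  qed
qed

end
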